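(* Let $n\ge 3$ be an integer. (Extremal families.) Let $p\in(0,1/2]$ and let $\mathcal{F}$ be an odd-cycle-intersecting family of subgraphs of $K_n$. Then $\mu_p(\mathcal{F})\le p^3$, with equality if and only if $\mathcal{F}$ is a $\triangle$umvirate. Furthermore, in the case $p=1/2$, if $\mathcal{F}$ is odd-cycle-agreeing then $\mu_{1/2}(\mathcal{F})\le 1/8$, with equality if and only if $\mathcal{F}$ is a triangle junta. (Stability.) For each $p\in(0,1/2]$ there exists a constant $c_p$, not depending on $n$, such that $\sup_{p\in[\delta,1/2]}c_p<\infty$ for every fixed $\delta>0$, and such that for any $\epsilon\ge 0$: if $\mathcal{F}$ is an odd-cycle-intersecting family of subgraphs of $K_n$ with $\mu_p(\mathcal{F})\ge p^3-\epsilon$, then there exists a $\triangle$umvirate $\mathcal{T}$ with $\mu_p(\mathcal{T}\,\Delta\,\mathcal{F})\le c_p\epsilon$. For $p=1/2$, the corresponding statement holds for odd-cycle-agreeing families: if $\mathcal{F}$ is odd-cycle-agreeing with $\mu_{1/2}(\mathcal{F})\ge 1/8-\epsilon$, then there is a triangle junta $\mathcal{T}$ with $\mu_{1/2}(\mathcal{T}\,\Delta\,\mathcal{F})\le c_{1/2}\epsilon$.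
   Context: Subgraphs of $K_n$ are identified with their edge sets, subsets of $[n]^{(2)}$; $\oplus$ (or $\Delta$) denotes symmetric difference and $\overline{G}$ the complement $K_n\setminus G$. For $p\in[0,1]$ and a graph $G\subseteq K_n$, $\mu_p(G)=p^{|G|}(1-p)^{\binom n2-|G|}$ (the probability that $G(n,p)=G$), and for a family $\mathcal{F}$, $\mu_p(\mathcal{F})=\sum_{G\in\mathcal{F}}\mu_p(G)$. A family $\mathcal{F}$ is odd-cycle-intersecting if for all $G,H\in\mathcal{F}$, $G\cap H$ contains an odd cycle; it is odd-cycle-agreeing if for all $G,H\in\mathcal{F}$, $\overline{G\oplus H}$ contains an odd cycle. A triangle junta is the family of all subgraphs of $K_n$ having a prescribed intersection with a given triangle $T$ (i.e. $\{G: G\cap T=S\}$ for some fixed triangle $T$ and $S\subseteq T$). A $\triangle$umvirate is the family of all subgraphs of $K_n$ containing a given triangle. *)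

theory Defs
  imports Complex_Main
begin

text \<open>A graph on the vertex set \<open>{1..n}\<close> is a set of edges, an edge being a two-element
  set of vertices; the subgraphs of \<open>K n\<close> are the elements of \<open>Pow (K n)\<close>.\<close>

type_synonym graph = "nat set set"

definition K :: "nat \<Rightarrow> graph" where
  "K n = {e. e \<subseteq> {1..n} \<and> card e = 2}"

definition mu_graph :: "nat \<Rightarrow> real \<Rightarrow> graph \<Rightarrow> real" where
  "mu_graph n p G = p ^ card G * (1 - p) ^ ((n choose 2) - card G)"

definition mu :: "nat \<Rightarrow> real \<Rightarrow> graph set \<Rightarrow> real" where
  "mu n p F = (\<Sum>G\<in>F. mu_graph n p G)"

text \<open>The edge set of the closed walk visiting the vertices of \<open>vs\<close> in order and
  returning to the first one.\<close>

definition closed_walk_edges :: "nat list \<Rightarrow> graph" where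
  "closed_walk_edges vs = {{vs ! i, vs ! (Suc i mod length vs)} | i. i < length vs}"

definition odd_cycle :: "graph \<Rightarrow> bool" where
  "odd_cycle C \<longleftrightarrow>
     (\<exists>vs. distinct vs \<and> 3 \<le> length vs \<and> odd (length vs) \<and> C = closed_walk_edges vs)"

definition contains_odd_cycle :: "graph \<Rightarrow> bool" where
  "contains_odd_cycle G \<longleftrightarrow> (\<exists>C. odd_cycle C \<and> C \<subseteq> G)"

definition odd_cycle_intersecting :: "nat \<Rightarrow> graph set \<Rightarrow> bool" where
  "odd_cycle_intersecting n F \<longleftrightarrow>
     F \<subseteq> Pow (K n) \<and> (\<forall>G\<in>F. \<forall>H\<in>F. contains_odd_cycle (G \<inter> H))"

definition odd_cycle_agreeing :: "nat \<Rightarrow> graph set \<Rightarrow> bool" where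
  "odd_cycle_agreeing n F \<longleftrightarrow>
     F \<subseteq> Pow (K n) \<and> (\<forall>G\<in>F. \<forall>H\<in>F. contains_odd_cycle (K n - sym_diff G H))"

definition triangle :: "nat \<Rightarrow> graph \<Rightarrow> bool" where
  "triangle n T \<longleftrightarrow>
     (\<exists>a b c. {a, b, c} \<subseteq> {1..n} \<and> distinct [a, b, c] \<and> T = {{a, b}, {b, c}, {a, c}})"

definition triangle_junta :: "nat \<Rightarrow> graph set \<Rightarrow> bool" where
  "triangle_junta n F \<longleftrightarrow> (\<exists>T S. triangle n T \<and> S \<subseteq> T \<and> F = {G. G \<subseteq> K n \<and> G \<inter> T = S})"

definition triangle_umvirate :: "nat \<Rightarrow> graph set \<Rightarrow> bool" where
  "triangle_umvirate n F \<longleftrightarrow> (\<exists>T. triangle n T \<and> F = {G. G \<subseteq> K n \<and> T \<subseteq> G})"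

end

(* Let p = 1/2 and let f be the indicator of an odd-cycle-agreeing family of measure mu. For a cut B
   and any function phi, the sum over R of (-1)^|R| phi(R cap B) f^(R)^2 vanishes, because two members
   of the family always agree on an edge outside B. Averaging over random cuts, with phi essentially a
   function of |R cap B|, gives multipliers equal to 1 at R = {}, at least -1/7 elsewhere, and bounded
   away from -1/7 if |R| >= 4. Hoffman's argument then yields mu <= 1/8 and bounds the Fourier weight
   W above level three by a multiple of 1/8 - mu.

   An integer-valued fourth derivative along disjoint directions kills all levels up to three, so it
   is nonzero on a set of measure O(W); consequently all fourth derivatives modulo 2 of f, along
   arbitrary directions, have measure O(W). As for minimum weight words of a Reed-Muller code, every
   shift y then either almost fixes the family or almost moves it off itself. The shifts of the first
   kind form a subgroup of index 8 without complements of bipartite graphs. Any three edges that are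
   independent modulo it hence form a triangle T, the subgroup consists of all graphs disjoint from T,
   and f is close to a junta on T.

   For p < 1/2 one passes to the up-closure and uses that log_p (mu_p(F)) does not increase with p for
   increasing F. *)

theory Submission
  imports Defs
begin

subsection \<open>Fourier analysis on the cube\<close>

text \<open>The value -1/7 is what Hoffman's bound needs for 1/8, since (1/7) / (1 + 1/7) = 1/8. For
  fixed R the sets R \<inter> B form a binary linear code on R, and a random cut gives a uniform
  word of it, so each multiplier is bounded through weight distributions. Distinct edges give
  distinct coordinates, which fixes the first two moments of the weight. The value 3/28 of
  \<open>phi\<close> comes from two competing graphs. With a common value v at weight four, a forest
  with four edges demands 4 * phi_3 + v \<ge> 3/7, while K_4 minus an edge demands 4 * phi_3 + v
  \<le> 3/7. Both would be tight, so \<open>phi\<close> cannot depend on the weight alone if the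
  levels above three are to be kept away from -1/7. For stability, a Fourier weight of order 1/8 -
  \<mu> has to give a distance of the same order. Integrality achieves this, as a nonzero integer
  has square at least 1. The integer argument needs disjoint directions, because a single edge of R
  could meet all four otherwise; repeated directions are harmless only modulo 2, hence the passage
  from integers to parities.\<close>

definition chi :: "'a set \<Rightarrow> 'a set \<Rightarrow> real" where
  "chi R G = (\<Prod>e\<in>R. if e \<in> G then -1 else 1)"

definition fourier :: "'a set \<Rightarrow> ('a set \<Rightarrow> real) \<Rightarrow> 'a set \<Rightarrow> real" where
  "fourier E g R = (\<Sum>G\<in>Pow E. g G * chi R G) / 2 ^ card E"

lemma chi_empty [simp]: "chi {} G = 1" "chi R {} = 1"
  by (simp_all add: chi_def)

lemma chi_sym_diff: "chi R (sym_diff G H) = chi R G * chi R H"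
  unfolding chi_def prod.distrib[symmetric] by (intro prod.cong) auto

lemma chi_sq: "chi R G * chi R G = 1"
  unfolding chi_def prod.distrib[symmetric] by (intro prod.neutral) auto

lemma chi_cases: "chi R G = 1 \<or> chi R G = -1"
  using chi_sq[of R G] square_eq_1_iff by auto

lemma chi_eq_power: "finite R \<Longrightarrow> chi R G = (-1) ^ card (R \<inter> G)"
  unfolding chi_def by (simp add: prod.If_cases Int_def)

lemma chi_commute: "finite R \<Longrightarrow> finite G \<Longrightarrow> chi R G = chi G R"
  by (simp add: chi_eq_power Int_commute)

lemma chi_disjoint: "R \<inter> G = {} \<Longrightarrow> chi R G = 1"
  unfolding chi_def by (intro prod.neutral) auto

lemma sum_chi_Pow:
  assumes "finite X"
  shows "(\<Sum>R\<in>Pow X. chi R G) = (if X \<inter> G = {} then 2 ^ card X else 0)"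
proof -
  have "(\<Sum>R\<in>Pow X. chi R G) = (\<Prod>e\<in>X. (if e \<in> G then -1 else 1) + 1)"
    unfolding chi_def by (subst prod_add[OF assms]) simp
  also have "\<dots> = (if X \<inter> G = {} then 2 ^ card X else 0)"
  proof (cases "X \<inter> G = {}")
    case True
    then have "(\<Prod>e\<in>X. (if e \<in> G then -1 else 1) + 1) = (\<Prod>e\<in>X. 2::real)"
      by (intro prod.cong) auto
    then show ?thesis using True by simp
  next
    case False
    then show ?thesis using assms by (auto intro!: prod_zero)
  qed
  finally show ?thesis .
qed

lemma sum_shift:
  assumes "y \<subseteq> E"
  shows "(\<Sum>G\<in>Pow E. g (sym_diff G y)) = (\<Sum>G\<in>Pow E. g G)"
  by (rule sum.reindex_bij_witness[of _ "\<lambda>G. sym_diff G y" "\<lambda>G. sym_diff G y"])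
    (use assms in \<open>auto intro!: arg_cong[where f = g]\<close>)

lemma fourier_shift:
  assumes "y \<subseteq> E"
  shows "fourier E (\<lambda>G. g (sym_diff G y)) R = chi R y * fourier E g R"
proof -
  have chi: "chi R G = chi R y * chi R (sym_diff G y)" for G
    using chi_sq[of R y] by (simp add: chi_sym_diff)
  have "(\<Sum>G\<in>Pow E. g (sym_diff G y) * chi R G)
      = (\<Sum>G\<in>Pow E. chi R y * (g (sym_diff G y) * chi R (sym_diff G y)))"
    by (subst chi) (simp only: mult_ac)
  also have "\<dots> = chi R y * (\<Sum>G\<in>Pow E. g G * chi R G)"
    using sum_shift[OF assms, of "\<lambda>G. chi R y * (g G * chi R G)"] by (simp only: sum_distrib_left)
  finally show ?thesis by (simp add: fourier_def)
qed

lemma fourier_diff: "fourier E (\<lambda>G. g G - h G) R = fourier E g R - fourier E h R"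
  by (simp add: fourier_def sum_subtractf left_diff_distrib diff_divide_distrib)

text \<open>The weight \<open>w\<close> enters only through its own transform at
  \<open>sym_diff G H\<close>. For constant \<open>w\<close> this yields Parseval's identity; for
  the weight of a cut it vanishes on every pair of members of an agreeing family.\<close>

lemma sum_fourier_sq_mult:
  assumes "finite E"
  shows "(\<Sum>R\<in>Pow E. w R * (fourier E g R)\<^sup>2)
    = (\<Sum>G\<in>Pow E. \<Sum>H\<in>Pow E. g G * g H * (\<Sum>R\<in>Pow E. w R * chi R (sym_diff G H))) / 4 ^ card E"
proof -
  have "w R * (fourier E g R)\<^sup>2 = (\<Sum>G\<in>Pow E. \<Sum>H\<in>Pow E. g G * g H * (w R * chi R (sym_diff G H))) / 4 ^ card E"
    for R
  proof -
    have "(2::real) ^ card E * 2 ^ card E = 4 ^ card E"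
      by (simp flip: power_mult_distrib)
    then have "w R * (fourier E g R)\<^sup>2
        = w R * ((\<Sum>G\<in>Pow E. g G * chi R G) * (\<Sum>H\<in>Pow E. g H * chi R H)) / 4 ^ card E"
      by (simp add: fourier_def power2_eq_square)
    also have "\<dots> = (\<Sum>G\<in>Pow E. \<Sum>H\<in>Pow E. g G * g H * (w R * chi R (sym_diff G H))) / 4 ^ card E"
      by (simp only: sum_product sum_distrib_left chi_sym_diff mult_ac)
    finally show ?thesis .
  qed
  then have "(\<Sum>R\<in>Pow E. w R * (fourier E g R)\<^sup>2)
    = (\<Sum>R\<in>Pow E. \<Sum>G\<in>Pow E. \<Sum>H\<in>Pow E. g G * g H * (w R * chi R (sym_diff G H))) / 4 ^ card E"
    by (simp only: sum_divide_distrib)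
  also have "(\<Sum>R\<in>Pow E. \<Sum>G\<in>Pow E. \<Sum>H\<in>Pow E. g G * g H * (w R * chi R (sym_diff G H)))
    = (\<Sum>G\<in>Pow E. \<Sum>R\<in>Pow E. \<Sum>H\<in>Pow E. g G * g H * (w R * chi R (sym_diff G H)))"
    by (rule sum.swap)
  also have "\<dots> = (\<Sum>G\<in>Pow E. \<Sum>H\<in>Pow E. g G * g H * (\<Sum>R\<in>Pow E. w R * chi R (sym_diff G H)))"
    unfolding sum_distrib_left by (intro sum.cong refl sum.swap)
  finally show ?thesis .
qed

lemma parseval:
  assumes "finite E"
  shows "(\<Sum>R\<in>Pow E. (fourier E g R)\<^sup>2) = (\<Sum>G\<in>Pow E. (g G)\<^sup>2) / 2 ^ card E"
proof -
  have "(\<Sum>R\<in>Pow E. (fourier E g R)\<^sup>2)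
    = (\<Sum>G\<in>Pow E. \<Sum>H\<in>Pow E. g G * g H * (\<Sum>R\<in>Pow E. chi R (sym_diff G H))) / 4 ^ card E"
    using sum_fourier_sq_mult[OF assms, of "\<lambda>_. 1" g] by simp
  also have "(\<Sum>G\<in>Pow E. \<Sum>H\<in>Pow E. g G * g H * (\<Sum>R\<in>Pow E. chi R (sym_diff G H)))
    = (\<Sum>G\<in>Pow E. \<Sum>H\<in>Pow E. if H = G then (g G)\<^sup>2 * 2 ^ card E else 0)"
  proof (intro sum.cong refl)
    fix G H assume GH: "G \<in> Pow E" "H \<in> Pow E"
    then have "E \<inter> sym_diff G H = {} \<longleftrightarrow> H = G" by blast
    then show "g G * g H * (\<Sum>R\<in>Pow E. chi R (sym_diff G H)) = (if H = G then (g G)\<^sup>2 * 2 ^ card E else 0)"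
      unfolding sum_chi_Pow[OF assms] by (auto simp: power2_eq_square)
  qed
  also have "\<dots> = (\<Sum>G\<in>Pow E. (g G)\<^sup>2) * 2 ^ card E"
    using assms by (simp add: sum.delta' sum_distrib_right)
  also have "(4::real) ^ card E = 2 ^ card E * 2 ^ card E"
    by (simp flip: power_mult_distrib)
  finally show ?thesis by (simp add: field_simps)
qed

subsection \<open>Derivatives of Boolean functions\<close>

definition deriv :: "'a set \<Rightarrow> ('a set \<Rightarrow> bool) \<Rightarrow> 'a set \<Rightarrow> bool" where
  "deriv y h x \<longleftrightarrow> h x \<noteq> h (sym_diff x y)"

definition density :: "'a set \<Rightarrow> ('a set \<Rightarrow> bool) \<Rightarrow> real" where
  "density E h = (\<Sum>x\<in>Pow E. of_bool (h x)) / 2 ^ card E"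

lemma density_nonneg: "0 \<le> density E h"
  by (simp add: density_def sum_nonneg)

lemma density_le_1: "finite E \<Longrightarrow> density E h \<le> 1"
proof -
  assume "finite E"
  then have "(\<Sum>x\<in>Pow E. of_bool (h x)) \<le> (\<Sum>x\<in>Pow E. 1::real)"
    by (intro sum_mono) auto
  also have "\<dots> = 2 ^ card E" using \<open>finite E\<close> by (simp add: card_Pow)
  finally show ?thesis by (simp add: density_def)
qed

lemma density_shift: "y \<subseteq> E \<Longrightarrow> density E (\<lambda>x. h (sym_diff x y)) = density E h"
  unfolding density_def by (subst sum_shift[of y E "\<lambda>x. of_bool (h x)"]) auto

lemma density_mono: "(\<And>x. x \<subseteq> E \<Longrightarrow> h x \<Longrightarrow> k x) \<Longrightarrow> density E h \<le> density E k"
  unfolding density_def by (intro divide_right_mono sum_mono) auto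

lemma density_disj_le:
  assumes "\<And>x. x \<subseteq> E \<Longrightarrow> h x \<Longrightarrow> k x \<or> l x"
  shows "density E h \<le> density E k + density E l"
proof -
  have "(\<Sum>x\<in>Pow E. of_bool (h x)) \<le> (\<Sum>x\<in>Pow E. of_bool (k x) + of_bool (l x) :: real)"
    using assms by (intro sum_mono) auto
  then show ?thesis
    unfolding density_def by (simp add: sum.distrib divide_right_mono flip: add_divide_distrib)
qed

lemma sym_diff_assoc: "sym_diff (sym_diff a b) c = sym_diff a (sym_diff b c)"
  by blast

lemma deriv_sym_diff: "deriv (sym_diff a b) h x \<Longrightarrow> deriv a h x \<or> deriv b h (sym_diff x a)"
  unfolding deriv_def sym_diff_assoc by blast

lemma deriv_deriv_commute: "deriv a (deriv b h) = deriv b (deriv a h)"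
proof
  fix x
  have "sym_diff (sym_diff x a) b = sym_diff (sym_diff x b) a" by blast
  then show "deriv a (deriv b h) x = deriv b (deriv a h) x"
    unfolding deriv_def by auto
qed

lemma deriv_deriv_same: "\<not> deriv a (deriv a h) x"
proof -
  have "sym_diff (sym_diff x a) a = x" by blast
  then show ?thesis unfolding deriv_def by auto
qed

text \<open>Triangle inequality for the distance between \<open>h\<close> and its translates. It
  makes the almost-stabiliser of a family closed under sums.\<close>

lemma density_deriv_sym_diff_le:
  assumes "a \<subseteq> E" "b \<subseteq> E"
  shows "density E (deriv (sym_diff a b) h) \<le> density E (deriv a h) + density E (deriv b h)"
proof -
  have "density E (deriv (sym_diff a b) h) \<le> density E (deriv a h) + density E (\<lambda>x. deriv b h (sym_diff x a))"
    using deriv_sym_diff by (intro density_disj_le) blast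
  then show ?thesis using density_shift[OF assms(1), of "deriv b h"] by simp
qed

lemma density_deriv_le: "y \<subseteq> E \<Longrightarrow> density E (deriv y h) \<le> 2 * density E h"
  using density_disj_le[of E "deriv y h" h "\<lambda>x. h (sym_diff x y)", unfolded deriv_def] density_shift[of y E h]
  unfolding deriv_def by linarith

lemma density_deriv_disjoint:
  assumes "y \<subseteq> E" "\<And>x. x \<subseteq> E \<Longrightarrow> h x \<Longrightarrow> \<not> h (sym_diff x y)"
  shows "density E (deriv y h) = 2 * density E h"
proof -
  have "(\<Sum>x\<in>Pow E. of_bool (deriv y h x) :: real) = (\<Sum>x\<in>Pow E. of_bool (h x) + of_bool (h (sym_diff x y)))"
  proof (intro sum.cong refl)
    fix x assume "x \<in> Pow E"
    then show "(of_bool (deriv y h x) :: real) = of_bool (h x) + of_bool (h (sym_diff x y))"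
      using assms(2)[of x] by (cases "h x") (simp_all add: deriv_def)
  qed
  also have "\<dots> = 2 * (\<Sum>x\<in>Pow E. of_bool (h x))"
    using sum_shift[OF assms(1), of "\<lambda>x. of_bool (h x) :: real"] by (simp add: sum.distrib)
  finally show ?thesis by (simp add: density_def)
qed

text \<open>For uniform \<open>x\<close> and \<open>y\<close> the points \<open>x\<close> and
  \<open>sym_diff x y\<close> are independent and uniform, so the average counts the pairs that
  \<open>h\<close> separates.\<close>

lemma sum_density_deriv:
  assumes "finite E"
  shows "(\<Sum>y\<in>Pow E. density E (deriv y h)) = 2 ^ card E * (2 * density E h * (1 - density E h))"
proof -
  let ?N = "2 ^ card E :: real"
  let ?s = "\<Sum>x\<in>Pow E. of_bool (h x) :: real"
  have "(\<Sum>y\<in>Pow E. \<Sum>x\<in>Pow E. of_bool (deriv y h x) :: real) = (\<Sum>x\<in>Pow E. \<Sum>y\<in>Pow E. of_bool (h x \<noteq> h y))"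
  proof (subst sum.swap, rule sum.cong[OF refl])
    fix x assume "x \<in> Pow E"
    moreover have "sym_diff x y = sym_diff y x" for y by blast
    ultimately show "(\<Sum>y\<in>Pow E. of_bool (deriv y h x) :: real) = (\<Sum>y\<in>Pow E. of_bool (h x \<noteq> h y))"
      using sum_shift[of x E "\<lambda>y. of_bool (h x \<noteq> h y) :: real"] by (simp add: deriv_def)
  qed
  also have "\<dots> = (\<Sum>x\<in>Pow E. \<Sum>y\<in>Pow E. of_bool (h x) + of_bool (h y) - 2 * (of_bool (h x) * of_bool (h y)))"
    by (intro sum.cong) auto
  also have "\<dots> = ?N * ?s + ?N * ?s - 2 * (?s * ?s)"
    using assms
    by (simp only: sum.distrib sum_subtractf sum_constant sum_distrib_left[symmetric] sum_distrib_right[symmetric])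
      (simp add: card_Pow algebra_simps del: sum_of_bool_eq)
  finally have "(\<Sum>y\<in>Pow E. density E (deriv y h)) = (?N * ?s + ?N * ?s - 2 * (?s * ?s)) / ?N"
    by (simp only: density_def sum_divide_distrib[symmetric])
  moreover have "(N * s + N * s - 2 * (s * s)) / N = N * (2 * (s / N) * (1 - s / N))" if "N > 0" for N s :: real
    using that by (simp add: field_simps)
  ultimately show ?thesis by (simp only: density_def) simp
qed

section \<open>Integer derivatives and Fourier levels\<close>

definition int_deriv :: "'a set \<Rightarrow> ('a set \<Rightarrow> int) \<Rightarrow> 'a set \<Rightarrow> int" where
  "int_deriv y g x = g (sym_diff x y) - g x"

lemma deriv_odd: "deriv y (\<lambda>x. odd (g x)) = (\<lambda>x. odd (int_deriv y g x))"
  by (auto simp: deriv_def int_deriv_def)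

text \<open>Over the integers a derivative multiplies each coefficient by 0 or -2, and by 0 whenever
  \<open>R\<close> misses \<open>y\<close>.\<close>

lemma fourier_int_deriv:
  assumes "y \<subseteq> E"
  shows "fourier E (\<lambda>x. of_int (int_deriv y g x)) R = (chi R y - 1) * fourier E (\<lambda>x. of_int (g x)) R"
  using fourier_shift[OF assms, of "\<lambda>x. of_int (g x)"]
  by (simp add: int_deriv_def fourier_diff algebra_simps)

lemma disjoint_from_one_of_four:
  assumes "finite R" "card R \<le> 3"
    and "a \<inter> b = {}" "a \<inter> c = {}" "a \<inter> d = {}" "b \<inter> c = {}" "b \<inter> d = {}" "c \<inter> d = {}"
  shows "R \<inter> a = {} \<or> R \<inter> b = {} \<or> R \<inter> c = {} \<or> R \<inter> d = {}"
proof (rule ccontr)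
  assume "\<not> ?thesis"
  then obtain p q r s where "p \<in> R \<inter> a" "q \<in> R \<inter> b" "r \<in> R \<inter> c" "s \<in> R \<inter> d"
    by blast
  moreover from this have "p \<noteq> q" "p \<noteq> r" "p \<noteq> s" "q \<noteq> r" "q \<noteq> s" "r \<noteq> s"
    using assms(3-) by auto
  then have "card {p, q, r, s} = 4" by simp
  ultimately show False
    using card_mono[of R "{p, q, r, s}"] assms(1,2) by auto
qed

text \<open>A set of at most three elements misses one of four disjoint directions, which kills its
  coefficient. On higher levels four factors of absolute value at most 2 contribute at most 256 =
  4^4 after squaring. An odd integer has square at least 1, so the norm bounds the density.\<close>

lemma density_deriv4_disjoint:
  fixes h :: "'a set \<Rightarrow> bool"
  assumes E: "finite E"
    and y: "a \<subseteq> E" "b \<subseteq> E" "c \<subseteq> E" "d \<subseteq> E"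
    and dj: "a \<inter> b = {}" "a \<inter> c = {}" "a \<inter> d = {}" "b \<inter> c = {}" "b \<inter> d = {}" "c \<inter> d = {}"
  shows "density E (deriv a (deriv b (deriv c (deriv d h))))
    \<le> 256 * (\<Sum>R | R \<subseteq> E \<and> 4 \<le> card R. (fourier E (\<lambda>x. of_bool (h x)) R)\<^sup>2)"
proof -
  define g where "g = (\<lambda>x. of_bool (h x) :: int)"
  define k where "k = int_deriv a (int_deriv b (int_deriv c (int_deriv d g)))"
  define f where "f = fourier E (\<lambda>x. of_bool (h x))"
  have h: "h = (\<lambda>x. odd (g x))"
    by (auto simp: g_def)
  have "density E (deriv a (deriv b (deriv c (deriv d h)))) = density E (\<lambda>x. odd (k x))"
    unfolding h k_def deriv_odd ..
  also have "\<dots> \<le> (\<Sum>x\<in>Pow E. (of_int (k x))\<^sup>2) / 2 ^ card E"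
    unfolding density_def
  proof (intro divide_right_mono sum_mono)
    fix x
    have "1 \<le> (k x)\<^sup>2" if "odd (k x)"
      using that by (cases "k x = 0") (simp_all add: int_one_le_iff_zero_less)
    then have "(of_bool (odd (k x)) :: int) \<le> (k x)\<^sup>2"
      by (cases "odd (k x)") auto
    then show "(of_bool (odd (k x)) :: real) \<le> (of_int (k x))\<^sup>2"
      by (metis of_int_le_iff of_int_of_bool of_int_power)
  qed simp
  also have "\<dots> = (\<Sum>R\<in>Pow E. (fourier E (\<lambda>x. of_int (k x)) R)\<^sup>2)"
    by (rule parseval[OF E, symmetric])
  also have "\<dots> \<le> (\<Sum>R\<in>Pow E. if 4 \<le> card R then 256 * (f R)\<^sup>2 else 0)"
  proof (rule sum_mono)
    fix R assume R: "R \<in> Pow E"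
    have k: "fourier E (\<lambda>x. of_int (k x)) R = (chi R a - 1) * (chi R b - 1) * (chi R c - 1) * (chi R d - 1) * f R"
      by (simp add: k_def fourier_int_deriv y g_def f_def)
    show "(fourier E (\<lambda>x. of_int (k x)) R)\<^sup>2 \<le> (if 4 \<le> card R then 256 * (f R)\<^sup>2 else 0)"
    proof (cases "4 \<le> card R")
      case True
      then show ?thesis
        unfolding k using chi_cases[of R a] chi_cases[of R b] chi_cases[of R c] chi_cases[of R d]
        by (auto simp: power_mult_distrib)
    next
      case False
      then have "R \<inter> a = {} \<or> R \<inter> b = {} \<or> R \<inter> c = {} \<or> R \<inter> d = {}"
        using R E dj by (intro disjoint_from_one_of_four) (auto intro: finite_subset)
      then show ?thesis
        unfolding k using False by (auto simp: chi_disjoint)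
    qed
  qed
  also have "\<dots> = 256 * (\<Sum>R | R \<subseteq> E \<and> 4 \<le> card R. (f R)\<^sup>2)"
    using E by (simp add: sum.If_cases sum_distrib_left Int_def Pow_def conj_commute)
  finally show ?thesis by (simp add: f_def)
qed

lemma density_deriv_split:
  assumes "a \<subseteq> E"
  shows "density E (deriv a h) \<le> density E (deriv (a - s) h) + density E (deriv (a \<inter> s) h)"
proof -
  have "sym_diff (a - s) (a \<inter> s) = a" "a - s \<subseteq> E" "a \<inter> s \<subseteq> E" using assms by auto
  then show ?thesis using density_deriv_sym_diff_le[of "a - s" E "a \<inter> s" h] by metis
qed

text \<open>Splitting a direction along the overlap with another one produces a repeated direction,
  whose second derivative vanishes modulo 2.\<close>

lemma density_deriv_overlap:
  assumes "a \<subseteq> E" "b \<subseteq> E"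
  shows "density E (deriv (a \<inter> b) (deriv b h)) \<le> density E (deriv (a \<inter> b) (deriv (b - a) h))"
proof -
  have "density E (deriv b (deriv (a \<inter> b) h))
    \<le> density E (deriv (b - a) (deriv (a \<inter> b) h)) + density E (deriv (a \<inter> b) (deriv (a \<inter> b) h))"
    using density_deriv_split[OF assms(2), of "deriv (a \<inter> b) h" a] by (simp add: Int_commute)
  moreover have "density E (deriv (a \<inter> b) (deriv (a \<inter> b) h)) = 0"
    by (simp add: density_def deriv_deriv_same)
  ultimately show ?thesis
    by (simp only: deriv_deriv_commute[of "a \<inter> b" b h] deriv_deriv_commute[of "a \<inter> b" "b - a" h])
qed

text \<open>The directions are made disjoint one after another. Each overlap is split off as a
  separate term, in which \<open>density_deriv_overlap\<close> replaces the other direction by its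
  remainder. This costs 2 terms for \<open>c\<close>, 3 for \<open>b\<close> and 4 for
  \<open>a\<close>, and 24 = 2 * 3 * 4.\<close>

lemma density_deriv4:
  fixes h :: "'a set \<Rightarrow> bool"
  assumes disj: "\<And>a b c d. \<lbrakk>a \<subseteq> E; b \<subseteq> E; c \<subseteq> E; d \<subseteq> E; a \<inter> b = {}; a \<inter> c = {}; a \<inter> d = {};
      b \<inter> c = {}; b \<inter> d = {}; c \<inter> d = {}\<rbrakk> \<Longrightarrow> density E (deriv a (deriv b (deriv c (deriv d h)))) \<le> \<eta>"
    and sub: "a \<subseteq> E" "b \<subseteq> E" "c \<subseteq> E" "d \<subseteq> E"
  shows "density E (deriv a (deriv b (deriv c (deriv d h)))) \<le> 24 * \<eta>"
proof -
  define \<rho> where "\<rho> a b c d = density E (deriv a (deriv b (deriv c (deriv d h))))" for a b c d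
  have swap12: "\<rho> a b c d = \<rho> b a c d" for a b c d
    unfolding \<rho>_def by (subst deriv_deriv_commute) (rule refl)
  have swap23: "\<rho> a b c d = \<rho> a c b d" for a b c d
    unfolding \<rho>_def by (subst deriv_deriv_commute[of b c]) (rule refl)
  have swap34: "\<rho> a b c d = \<rho> a b d c" for a b c d
    unfolding \<rho>_def by (subst deriv_deriv_commute[of c d]) (rule refl)
  have split: "\<rho> a b c d \<le> \<rho> (a - s) b c d + \<rho> (a \<inter> s) b c d" if "a \<subseteq> E" for a b c d s
    unfolding \<rho>_def using density_deriv_split[OF that] .
  have overlap: "\<rho> (a \<inter> b) b c d \<le> \<rho> (a \<inter> b) (b - a) c d" if "a \<subseteq> E" "b \<subseteq> E" for a b c d
    unfolding \<rho>_def using density_deriv_overlap[OF that] .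
  have disj': "\<rho> a b c d \<le> \<eta>" if "a \<subseteq> E" "b \<subseteq> E" "c \<subseteq> E" "d \<subseteq> E" "a \<inter> b = {}" "a \<inter> c = {}" "a \<inter> d = {}"
      "b \<inter> c = {}" "b \<inter> d = {}" "c \<inter> d = {}" for a b c d
    unfolding \<rho>_def by (rule disj) (fact that)+
  have one: "\<rho> a b c d \<le> 4 * \<eta>"
    if sub: "a \<subseteq> E" "b \<subseteq> E" "c \<subseteq> E" "d \<subseteq> E" and "b \<inter> c = {}" "b \<inter> d = {}" "c \<inter> d = {}" for a b c d
  proof -
    have sub': "a - b \<subseteq> E" "a - b - c \<subseteq> E" using sub by auto
    have "\<rho> (a - b - c - d) b c d \<le> \<eta>"
      by (rule disj') (use that in blast)+
    moreover have "\<rho> (a \<inter> b) (b - a) c d \<le> \<eta>" "\<rho> ((a - b) \<inter> c) (c - (a - b)) b d \<le> \<eta>"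
      "\<rho> ((a - b - c) \<inter> d) (d - (a - b - c)) b c \<le> \<eta>"
      by (rule disj'; use that in blast)+
    moreover note split[OF sub(1), of b c d b] split[OF sub'(1), of b c d c] split[OF sub'(2), of b c d d]
      overlap[OF sub(1,2), of c d] overlap[OF sub'(1) sub(3), of b d] overlap[OF sub'(2) sub(4), of b c]
      swap23[of "(a - b) \<inter> c" b c d] swap34[of "(a - b - c) \<inter> d" b c d] swap23[of "(a - b - c) \<inter> d" b d c]
    ultimately show ?thesis by linarith
  qed
  have two: "\<rho> a b c d \<le> 12 * \<eta>"
    if sub: "a \<subseteq> E" "b \<subseteq> E" "c \<subseteq> E" "d \<subseteq> E" and "c \<inter> d = {}" for a b c d
  proof -
    have sub': "b - c \<subseteq> E" using sub by auto
    have "\<rho> a (b - c - d) c d \<le> 4 * \<eta>" "\<rho> a (b \<inter> c) (c - b) d \<le> 4 * \<eta>"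
      "\<rho> a ((b - c) \<inter> d) (d - (b - c)) c \<le> 4 * \<eta>"
      by (rule one; use that in blast)+
    moreover note split[OF sub(2), of a c d c] split[OF sub', of a c d d]
      overlap[OF sub(2,3), of a d] overlap[OF sub' sub(4), of a c] swap12[of a b c d]
      swap12[of a "b - c - d" c d] swap12[of a "b \<inter> c" "c - b" d] swap23[of "b \<inter> c" a "c - b" d]
      swap12[of a "(b - c) \<inter> d" "d - (b - c)" c] swap23[of "(b - c) \<inter> d" a "d - (b - c)" c]
      swap23[of "b \<inter> c" a c d] swap34[of "(b - c) \<inter> d" a c d] swap23[of "(b - c) \<inter> d" a d c]
    ultimately show ?thesis by linarith
  qed
  have "\<rho> a b (c - d) d \<le> 12 * \<eta>" "\<rho> a b (c \<inter> d) (d - c) \<le> 12 * \<eta>"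
    by (rule two; use sub in blast)+
  moreover note split[OF sub(3), of a b d d] overlap[OF sub(3,4), of a b]
    swap23[of a b c d] swap12[of a c b d] swap23[of a b "c - d" d] swap12[of a "c - d" b d]
    swap34[of "c \<inter> d" a b d] swap23[of "c \<inter> d" a d b]
    swap34[of "c \<inter> d" a "d - c" b] swap23[of "c \<inter> d" "d - c" a b] swap34[of "c \<inter> d" a b "d - c"]
    swap23[of a b "c \<inter> d" "d - c"] swap12[of a "c \<inter> d" b "d - c"]
  ultimately show ?thesis unfolding \<rho>_def[symmetric] by linarith
qed

section \<open>A gap in the possible densities\<close>

lemma density_gap_base:
  assumes "finite E" "\<And>y. y \<subseteq> E \<Longrightarrow> density E (deriv y h) \<le> \<eta>"
  shows "2 * density E h * (1 - density E h) \<le> \<eta>"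
proof -
  have "(\<Sum>y\<in>Pow E. density E (deriv y h)) \<le> (\<Sum>y\<in>Pow E. \<eta>)"
    using assms(2) by (intro sum_mono) auto
  then have "2 ^ card E * (2 * density E h * (1 - density E h)) \<le> 2 ^ card E * \<eta>"
    using assms(1) by (simp add: sum_density_deriv card_Pow)
  then show ?thesis by simp
qed

text \<open>A robust version of the fact that a nonzero polynomial of degree \<open>d\<close> over the two-element
  field takes the value \<open>1\<close> on a proportion at least \<open>2\<^sup>-\<^sup>d\<close> of the cube.\<close>

lemma density_gap:
  assumes "finite E" "0 \<le> \<eta>"
    and "\<And>ys. length ys = Suc d \<Longrightarrow> set ys \<subseteq> Pow E \<Longrightarrow> density E (foldr deriv ys h) \<le> \<eta>"
  shows "density E h \<le> \<eta> \<or> (1 - \<eta>) / 2 ^ d \<le> density E h"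
  using assms(3)
proof (induction d arbitrary: h)
  case 0
  let ?m = "density E h"
  have *: "2 * ?m * (1 - ?m) \<le> \<eta>"
    by (rule density_gap_base[OF assms(1)]) (use 0[of "[_]"] in simp)
  show ?case
  proof (cases "?m \<le> 1/2")
    case True
    then have "?m * 1 \<le> ?m * (2 * (1 - ?m))" by (intro mult_left_mono density_nonneg) simp
    then show ?thesis using * by (simp add: algebra_simps)
  next
    case False
    then have "(1 - ?m) * 1 \<le> (1 - ?m) * (2 * ?m)"
      by (intro mult_left_mono) (use density_le_1[OF assms(1), of h] in auto)
    then show ?thesis using * by (simp add: algebra_simps)
  qed
next
  case (Suc d)
  let ?m = "density E h"
  show ?case
  proof (cases "(1 - \<eta>) / 2 ^ Suc d \<le> ?m")
    case False
    \<comment> \<open>A derivative at most doubles the density, so below the threshold for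
      \<open>Suc d\<close> every derivative lies below the threshold for \<open>d\<close> and hence,
      by induction, is at most \<eta>. Averaging over all directions then bounds \<open>h\<close>
      itself.\<close>
    have "density E (deriv y h) \<le> \<eta>" if y: "y \<subseteq> E" for y
    proof -
      have "density E (deriv y h) \<le> \<eta> \<or> (1 - \<eta>) / 2 ^ d \<le> density E (deriv y h)"
      proof (rule Suc.IH)
        fix ys :: "'a set list" assume "length ys = Suc d" "set ys \<subseteq> Pow E"
        then show "density E (foldr deriv ys (deriv y h)) \<le> \<eta>"
          using Suc.prems[of "ys @ [y]"] y by simp
      qed
      moreover have "density E (deriv y h) < (1 - \<eta>) / 2 ^ d"
      proof -
        have "2 * density E h < 2 * ((1 - \<eta>) / 2 ^ Suc d)" using False by linarith
        also have "\<dots> = (1 - \<eta>) / 2 ^ d" by (simp add: field_simps)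
        finally show ?thesis using density_deriv_le[OF y, of h] by linarith
      qed
      ultimately show ?thesis by simp
    qed
    then have *: "2 * ?m * (1 - ?m) \<le> \<eta>" by (rule density_gap_base[OF assms(1)])
    have "(1 - \<eta>) / 2 ^ Suc d \<le> 1 / 2 ^ Suc d" using assms(2) by (intro divide_right_mono) auto
    also have "\<dots> \<le> 1 / 2" by simp
    finally have "?m \<le> 1/2" using False by linarith
    then have "?m * 1 \<le> ?m * (2 * (1 - ?m))" by (intro mult_left_mono density_nonneg) simp
    then show ?thesis using * by (simp add: algebra_simps)
  qed simp
qed

subsection \<open>Subgroups of the cube\<close>

definition cube_subgroup :: "'a set \<Rightarrow> 'a set set \<Rightarrow> bool" where
  "cube_subgroup E S \<longleftrightarrow> S \<subseteq> Pow E \<and> {} \<in> S \<and> (\<forall>x\<in>S. \<forall>y\<in>S. sym_diff x y \<in> S)"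

text \<open>For a subgroup \<open>S\<close> the quotient of the cube by \<open>S\<close> is a vector
  space over the two-element field. This is linear independence of the images of the singletons from
  \<open>I\<close>, and \<open>spanning_mod\<close> says that these images span.\<close>

definition independent_mod :: "'a set set \<Rightarrow> 'a set \<Rightarrow> bool" where
  "independent_mod S I \<longleftrightarrow> (\<forall>X. X \<subseteq> I \<and> X \<in> S \<longrightarrow> X = {})"

definition spanning_mod :: "'a set \<Rightarrow> 'a set set \<Rightarrow> 'a set \<Rightarrow> bool" where
  "spanning_mod E S I \<longleftrightarrow> (\<forall>Y. Y \<subseteq> E \<longrightarrow> (\<exists>X. X \<subseteq> I \<and> sym_diff X Y \<in> S))"

text \<open>A largest independent set spans: every further singleton depends on it, and the
  singletons generate the cube.\<close>

lemma ex_independent_spanning: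
  assumes E: "finite E" and S: "cube_subgroup E S"
  obtains I where "I \<subseteq> E" "independent_mod S I" "spanning_mod E S I"
proof -
  have "{} \<subseteq> E \<and> independent_mod S {}" by (auto simp: independent_mod_def)
  moreover have "\<forall>I. I \<subseteq> E \<and> independent_mod S I \<longrightarrow> card I < Suc (card E)"
    using E by (simp add: card_mono le_imp_less_Suc)
  ultimately have "\<exists>I. (I \<subseteq> E \<and> independent_mod S I) \<and> (\<forall>J. J \<subseteq> E \<and> independent_mod S J \<longrightarrow> card J \<le> card I)"
    by (rule ex_has_greatest_nat[where b = "Suc (card E)"])
  then obtain I where I: "I \<subseteq> E" "independent_mod S I"
    and max: "\<And>J. J \<subseteq> E \<and> independent_mod S J \<Longrightarrow> card J \<le> card I"
    by blast
  have single: "\<exists>X. X \<subseteq> I \<and> sym_diff X {e} \<in> S" if e: "e \<in> E" for e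
  proof (cases "e \<in> I")
    case True
    then show ?thesis using S by (intro exI[of _ "{e}"]) (simp add: cube_subgroup_def)
  next
    case False
    have "finite I" using I(1) E finite_subset by blast
    then have "\<not> independent_mod S (insert e I)"
      using max[of "insert e I"] False I(1) e by auto
    then obtain X where X: "X \<subseteq> insert e I" "X \<in> S" "X \<noteq> {}" unfolding independent_mod_def by blast
    then have "e \<in> X" using I(2) unfolding independent_mod_def by blast
    then have "sym_diff (X - {e}) {e} = X" "X - {e} \<subseteq> I" using X(1) by auto
    then show ?thesis using X(2) by metis
  qed
  have "\<exists>X. X \<subseteq> I \<and> sym_diff X Y \<in> S" if Y: "Y \<subseteq> E" for Y
  proof -
    have "finite Y" using Y E finite_subset by blast
    then show ?thesis using Y
    proof (induction Y)
      case empty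
      then show ?case using S by (intro exI[of _ "{}"]) (simp add: cube_subgroup_def)
    next
      case (insert e Y)
      obtain X1 where X1: "X1 \<subseteq> I" "sym_diff X1 {e} \<in> S" using single[of e] insert.prems by auto
      obtain X2 where X2: "X2 \<subseteq> I" "sym_diff X2 Y \<in> S" using insert by auto
      have "sym_diff (sym_diff X1 {e}) (sym_diff X2 Y) \<in> S"
        using X1(2) X2(2) S unfolding cube_subgroup_def by blast
      moreover have "sym_diff (sym_diff X1 {e}) (sym_diff X2 Y) = sym_diff (sym_diff X1 X2) (insert e Y)"
        using insert.hyps(2) by auto
      ultimately show ?case using X1(1) X2(1) by (intro exI[of _ "sym_diff X1 X2"]) auto
    qed
  qed
  then show ?thesis using that[OF I] by (auto simp: spanning_mod_def)
qed

text \<open>Independence makes the sum map from \<open>Pow I \<times> S\<close> to the cube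
  injective. Spanning says that it is onto, which counting then decides.\<close>

lemma spanning_mod_iff_card:
  assumes E: "finite E" and S: "cube_subgroup E S" and I: "I \<subseteq> E" "independent_mod S I"
  shows "spanning_mod E S I \<longleftrightarrow> 2 ^ card I * card S = 2 ^ card E"
proof -
  let ?F = "\<lambda>(X, s). sym_diff X s"
  let ?A = "?F ` (Pow I \<times> S)"
  have inj: "inj_on ?F (Pow I \<times> S)"
  proof -
    have "X = X' \<and> s = s'" if *: "X \<subseteq> I" "s \<in> S" "X' \<subseteq> I" "s' \<in> S" "sym_diff X s = sym_diff X' s'" for X s X' s'
    proof -
      have "sym_diff X X' = sym_diff s s'" using *(5) by blast
      then have "sym_diff X X' \<in> S" using * S unfolding cube_subgroup_def by metis
      moreover have "sym_diff X X' \<subseteq> I" using * by auto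
      ultimately have "sym_diff X X' = {}" using I(2) unfolding independent_mod_def by blast
      then show ?thesis using *(5) by blast
    qed
    then show ?thesis unfolding inj_on_def by (simp only: split_paired_Ball_Sigma) auto
  qed
  have sub: "?A \<subseteq> Pow E"
    using S I(1) unfolding cube_subgroup_def by auto
  have fin: "finite I" using I(1) E finite_subset by blast
  have card: "card ?A = 2 ^ card I * card S"
    using card_image[OF inj] fin by (simp add: card_cartesian_product card_Pow)
  have "spanning_mod E S I \<longleftrightarrow> Pow E \<subseteq> ?A"
  proof
    assume span: "spanning_mod E S I"
    show "Pow E \<subseteq> ?A"
    proof
      fix Y assume "Y \<in> Pow E"
      then obtain X where X: "X \<subseteq> I" "sym_diff X Y \<in> S" using span by (auto simp: spanning_mod_def)
      moreover have "Y = sym_diff X (sym_diff X Y)" by blast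
      ultimately show "Y \<in> ?A"
        by (intro image_eqI[of _ _ "(X, sym_diff X Y)"]) auto
    qed
  next
    assume A: "Pow E \<subseteq> ?A"
    show "spanning_mod E S I"
      unfolding spanning_mod_def
    proof (intro allI impI)
      fix Y assume "Y \<subseteq> E"
      then have "Y \<in> ?A" using subsetD[OF A] by blast
      then obtain p where p: "p \<in> Pow I \<times> S" "Y = ?F p" by (rule_tac imageE)
      then have "fst p \<subseteq> I" "snd p \<in> S" "Y = sym_diff (fst p) (snd p)" by (simp_all add: case_prod_beta mem_Times_iff)
      moreover from this(3) have "sym_diff (fst p) Y = snd p" by blast
      ultimately show "\<exists>X. X \<subseteq> I \<and> sym_diff X Y \<in> S" by metis
    qed
  qed
  also have "\<dots> \<longleftrightarrow> card ?A = card (Pow E)"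
  proof
    assume "Pow E \<subseteq> ?A"
    then have "?A = Pow E" by (rule equalityI[OF sub])
    then show "card ?A = card (Pow E)" by (rule arg_cong)
  next
    assume "card ?A = card (Pow E)"
    then have "?A = Pow E" using E by (intro card_subset_eq[OF _ sub]) auto
    then show "Pow E \<subseteq> ?A" by (rule equalityD2)
  qed
  finally show ?thesis using card E by (simp add: card_Pow)
qed

text \<open>Steinitz exchange: a relation involving a new \<open>e\<close>, added to the relation
  \<open>sym_diff x {e}\<close>, loses \<open>e\<close> and regains \<open>a\<close>, so it would be
  a nontrivial relation inside \<open>I\<close>.\<close>

lemma independent_exchange:
  assumes S: "cube_subgroup E S" and I: "independent_mod S I" and x: "x \<subseteq> I" "a \<in> x" "sym_diff x {e} \<in> S"
  shows "independent_mod S (insert e (I - {a}))"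
  unfolding independent_mod_def
proof (intro allI impI, elim conjE)
  fix X assume X: "X \<subseteq> insert e (I - {a})" "X \<in> S"
  show "X = {}"
  proof (cases "e \<in> X \<and> e \<notin> I")
    case True
    have "sym_diff X (sym_diff x {e}) \<in> S" using X x S unfolding cube_subgroup_def by blast
    moreover have "a \<in> sym_diff X (sym_diff x {e})" "sym_diff X (sym_diff x {e}) \<subseteq> I"
      using X(1) x True by auto
    ultimately show ?thesis using I unfolding independent_mod_def by blast
  next
    case False
    then have "X \<subseteq> I" using X(1) by auto
    then show ?thesis using I X(2) unfolding independent_mod_def by blast
  qed
qed

subsection \<open>Cuts and triangles\<close>

text \<open>The parity form makes a cut linear in its vertex set, see \<open>cut_sym_diff\<close>.
  The subsets of cuts are the bipartite graphs.\<close>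

definition cut_edges :: "nat \<Rightarrow> nat set \<Rightarrow> graph" where
  "cut_edges n U = {e \<in> K n. odd (card (e \<inter> U))}"

lemma K_E: assumes "e \<in> K n" obtains a b where "e = {a, b}" "a \<noteq> b" "a \<in> {1..n}" "b \<in> {1..n}"
  using assms unfolding K_def by (auto simp: card_2_iff)

lemma finite_K [simp]: "finite (K n)"
  by (rule finite_subset[of _ "Pow {1..n}"]) (auto simp: K_def)

lemma card_K [simp]: "card (K n) = n choose 2"
  unfolding K_def using n_subsets[of "{1..n}" 2] by simp

lemma odd_card_pair_Int: "a \<noteq> b \<Longrightarrow> odd (card ({a, b} \<inter> U)) \<longleftrightarrow> (a \<in> U) \<noteq> (b \<in> U)"
  by (cases "a \<in> U"; cases "b \<in> U") (simp_all add: Int_insert_left)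

lemma distinct_edges_E:
  assumes "e \<in> K n" "f \<in> K n" "e \<noteq> f"
  obtains x y where "x \<in> e" "x \<notin> f" "y \<in> f" "y \<notin> e"
  using assms(3) by (rule_tac K_E[OF assms(1)], rule_tac K_E[OF assms(2)]) (auto simp: doubleton_eq_iff)

text \<open>A vertex \<open>x\<close> of \<open>f\<close> outside \<open>g\<close> and a vertex
  \<open>y\<close> of \<open>g\<close> outside \<open>f\<close> already separate the ends of both
  edges. As \<open>v\<close> lies on neither of them, it can be put on whichever side cuts
  \<open>e\<close>.\<close>

lemma pendant_in_cut:
  assumes e: "e \<in> K n" "f \<in> K n" "g \<in> K n" "f \<noteq> g" and v: "v \<in> e" "v \<notin> f" "v \<notin> g"
  shows "\<exists>U. {e, f, g} \<subseteq> cut_edges n U"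
proof -
  obtain x y where xy: "x \<in> f" "x \<notin> g" "y \<in> g" "y \<notin> f" using distinct_edges_E[OF e(2,3,4)] by blast
  obtain w where w: "e = {v, w}" "v \<noteq> w" using K_E[OF e(1)] v(1) by auto
  obtain x' where x': "f = {x, x'}" "x \<noteq> x'" using K_E[OF e(2)] xy(1) by auto
  obtain y' where y': "g = {y, y'}" "y \<noteq> y'" using K_E[OF e(3)] xy(3) by auto
  define U where "U = (if w \<in> {x, y} then {x, y} else {x, y, v})"
  have "(v \<in> U) \<noteq> (w \<in> U)" using w v x' y' by (auto simp: U_def)
  moreover have "(x \<in> U) \<noteq> (x' \<in> U)" using v x' y' xy by (auto simp: U_def)
  moreover have "(y \<in> U) \<noteq> (y' \<in> U)" using v x' y' xy by (auto simp: U_def)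
  ultimately have "{e, f, g} \<subseteq> cut_edges n U"
    using e w x' y' unfolding cut_edges_def by (simp add: odd_card_pair_Int)
  then show ?thesis ..
qed

text \<open>By \<open>pendant_in_cut\<close> no vertex belongs to exactly one of the edges, and
  three distinct edges without a vertex of degree one form a triangle.\<close>

lemma triangle_if_not_in_cut:
  assumes e: "e \<in> K n" "f \<in> K n" "g \<in> K n" "e \<noteq> f" "e \<noteq> g" "f \<noteq> g"
    and nocut: "\<And>U. \<not> {e, f, g} \<subseteq> cut_edges n U"
  shows "triangle n {e, f, g}"
proof -
  have e_fg: "v \<in> f \<or> v \<in> g" if "v \<in> e" for v
    using pendant_in_cut[OF e(1,2,3,6)] nocut that by blast
  have f_eg: "v \<in> e \<or> v \<in> g" if "v \<in> f" for v
    using pendant_in_cut[OF e(2,1,3,5)] nocut[unfolded insert_commute[of e f]] that by blast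
  obtain a b where ab: "e = {a, b}" "a \<noteq> b" using K_E[OF e(1)] by metis
  have *: "triangle n {e, f, g}" if ab: "e = {a, b}" "a \<noteq> b" "a \<in> f" for a b
  proof -
    obtain c where c: "f = {a, c}" "a \<noteq> c" using K_E[OF e(2)] ab(3) by auto
    have "c \<noteq> b" using c ab e(4) by auto
    then have "c \<in> g" using f_eg[of c] c ab by auto
    moreover have "b \<in> g" using e_fg[of b] c ab \<open>c \<noteq> b\<close> by auto
    ultimately have g: "g = {b, c}" using K_E[OF e(3)] \<open>c \<noteq> b\<close> by auto
    have "{b, a, c} \<subseteq> {1..n}" using e(1,2) ab c by (auto simp: K_def)
    moreover have "{e, f, g} = {{b, a}, {a, c}, {b, c}}" using ab c g by (simp add: insert_commute)
    moreover have "distinct [b, a, c]" using ab c \<open>c \<noteq> b\<close> by simp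
    ultimately show ?thesis unfolding triangle_def by blast
  qed
  show ?thesis
  proof (cases "a \<in> f")
    case True
    then show ?thesis using * ab by blast
  next
    case False
    have "b \<in> f"
    proof (rule ccontr)
      assume "b \<notin> f"
      then have "e \<subseteq> g" using e_fg ab False by blast
      then show False using e(1,3,5) K_E[OF e(3)] ab by auto
    qed
    then show ?thesis using *[of b a] ab by (auto simp: insert_commute)
  qed
qed

lemma triangle_subset_K: "triangle n T \<Longrightarrow> T \<subseteq> K n"
  by (auto simp: triangle_def K_def)

lemma card_triangle: "triangle n T \<Longrightarrow> card T = 3"
  by (auto simp: triangle_def doubleton_eq_iff card_insert_if)

text \<open>Each edge of a triangle is the symmetric difference of the other two.\<close>

lemma triangles_share_two_edges:
  assumes "triangle n {e, f, g}" "triangle n {e', f, g}" "f \<noteq> g" "e \<noteq> f" "e \<noteq> g" "e' \<noteq> f" "e' \<noteq> g"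
  shows "e = e'"
proof -
  have "e = sym_diff f g" if t: "triangle n {e, f, g}" and ne: "f \<noteq> g" "e \<noteq> f" "e \<noteq> g" for e
  proof -
    obtain a b c where d: "distinct [a, b, c]" and T: "{e, f, g} = {{a, b}, {b, c}, {a, c}}"
      using t by (auto simp: triangle_def)
    have "e \<in> {{a, b}, {b, c}, {a, c}}" "f \<in> {{a, b}, {b, c}, {a, c}}" "g \<in> {{a, b}, {b, c}, {a, c}}"
      unfolding T[symmetric] by auto
    then show ?thesis using d ne by (elim insertE emptyE) auto
  qed
  then show ?thesis using assms by metis
qed

text \<open>If three edges are independent modulo \<open>S\<close> and form a forest, then the complement of some
  bipartite graph lies in \<open>S\<close>. So any three independent edges form a triangle, and the exchange
  property leaves no further edge outside \<open>S\<close>.\<close>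

lemma subgroup_index_8_triangle:
  assumes S: "cube_subgroup (K n) S" and card: "8 * card S = 2 ^ card (K n)"
    and bip: "\<And>U B. B \<subseteq> cut_edges n U \<Longrightarrow> K n - B \<notin> S"
  obtains T where "triangle n T" "S = Pow (K n - T)"
proof -
  have S0: "card S > 0" using card by (cases "card S") auto
  have trip: "triangle n I" if I: "I \<subseteq> K n" "independent_mod S I" "card I = 3" "spanning_mod (K n) S I" for I
  proof -
    obtain e f g where efg: "I = {e, f, g}" "e \<noteq> f" "e \<noteq> g" "f \<noteq> g" using I(3) by (auto simp: card_3_iff)
    have "\<not> I \<subseteq> cut_edges n U" for U
    proof
      assume U: "I \<subseteq> cut_edges n U"
      \<comment> \<open>\<open>X\<close> represents the coset of the complement of \<open>I\<close>,
        so the complement of \<open>I - X\<close> lies in \<open>S\<close> although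
        \<open>I - X\<close> is contained in a cut.\<close>
      obtain X where X: "X \<subseteq> I" "sym_diff X (K n - I) \<in> S"
        using I(4) unfolding spanning_mod_def by (metis Diff_subset)
      have "sym_diff X (K n - I) = K n - (I - X)" using X(1) I(1) by auto
      then show False using bip[of "I - X" U] X(2) U by auto
    qed
    then show ?thesis unfolding efg using I(1) efg by (intro triangle_if_not_in_cut) auto
  qed
  have card3: "card I = 3" if "I \<subseteq> K n" "independent_mod S I" "spanning_mod (K n) S I" for I
  proof -
    have "2 ^ card I * card S = 8 * card S"
      using spanning_mod_iff_card[OF finite_K S that(1,2)] that(3) card by simp
    then have "(2::nat) ^ card I = 2 ^ 3" using S0 by simp
    then show ?thesis by (subst (asm) power_inject_exp) auto
  qed
  have span: "spanning_mod (K n) S I" if "I \<subseteq> K n" "independent_mod S I" "card I = 3" for I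
    using spanning_mod_iff_card[OF finite_K S that(1,2)] that(3) card by simp
  obtain I where I: "I \<subseteq> K n" "independent_mod S I" "spanning_mod (K n) S I"
    using ex_independent_spanning[OF finite_K S] .
  have tri: "triangle n I" using trip I card3 by blast
  have sing: "{e} \<in> S" if e: "e \<in> K n" "e \<notin> I" for e
  proof (rule ccontr)
    assume eS: "{e} \<notin> S"
    obtain X where X: "X \<subseteq> I" "sym_diff X {e} \<in> S"
      using I(3) e(1) unfolding spanning_mod_def by (metis empty_subsetI insert_subset)
    have "X \<noteq> {}" using eS X(2) by auto
    then obtain a where a: "a \<in> X" by blast
    then have aI: "a \<in> I" using X(1) by blast
    then have "card (I - {a}) = 2" using card3[OF I] by simp
    then obtain f g where fg: "I - {a} = {f, g}" "f \<noteq> g" by (auto simp: card_2_iff)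
    then have I3: "I = {a, f, g}" "a \<noteq> f" "a \<noteq> g" "f \<noteq> g" using aI by blast+
    let ?J = "insert e (I - {a})"
    have J: "?J = {e, f, g}" using fg by simp
    \<comment> \<open>Exchanging \<open>a\<close> for \<open>e\<close> gives another basis, hence
      another triangle with the edges \<open>f\<close> and \<open>g\<close>. So \<open>e\<close>
      would equal \<open>a\<close>, but \<open>e\<close> is not in \<open>I\<close>.\<close>
    have "independent_mod S ?J" using independent_exchange[OF S I(2) X(1) a X(2)] .
    moreover have "?J \<subseteq> K n" "card ?J = 3" using e I3 I(1) by auto
    ultimately have "triangle n {e, f, g}" using trip span J by metis
    then show False using triangles_share_two_edges[of n e f g a] tri I3 e(2) by auto
  qed
  have "Pow (K n - I) \<subseteq> S"
  proof
    fix Y assume "Y \<in> Pow (K n - I)"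
    then have "finite Y" "Y \<subseteq> K n - I" using finite_subset[of Y "K n"] by auto
    then show "Y \<in> S"
    proof (induction Y)
      case empty
      then show ?case using S by (simp add: cube_subgroup_def)
    next
      case (insert e Y)
      then have "{e} \<in> S" "Y \<in> S" using sing[of e] by auto
      then have "sym_diff {e} Y \<in> S" using S unfolding cube_subgroup_def by blast
      moreover have "sym_diff {e} Y = insert e Y" using insert by auto
      ultimately show ?case by simp
    qed
  qed
  moreover have "card S \<le> card (Pow (K n - I))"
  proof -
    have c: "card (K n) = card (K n - I) + 3"
      using card_Diff_subset[of I "K n"] card_mono[OF finite_K I(1)] card3[OF I] I(1) finite_subset[OF I(1)] by auto
    then have "(2::nat) ^ card (K n) = 8 * 2 ^ card (K n - I)"
      unfolding c by (simp add: power_add)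
    then show ?thesis using card by (simp add: card_Pow)
  qed
  moreover have "finite S"
    using S finite_subset[of S "Pow (K n)"] by (simp add: cube_subgroup_def)
  ultimately have "Pow (K n - I) = S"
    by (intro card_seteq)
  then show ?thesis using that[OF tri] by simp
qed

subsection \<open>Weights of separating binary codes\<close>

lemma card_subsets_card_in:
  assumes "finite I" "finite A"
  shows "card {J. J \<subseteq> I \<and> card J \<in> A} = (\<Sum>k\<in>A. card I choose k)"
proof -
  have "{J. J \<subseteq> I \<and> card J \<in> A} = (\<Union>k\<in>A. {J. J \<subseteq> I \<and> card J = k})" by auto
  moreover have "card (\<Union>k\<in>A. {J. J \<subseteq> I \<and> card J = k}) = (\<Sum>k\<in>A. card {J. J \<subseteq> I \<and> card J = k})"
    by (rule card_UN_disjoint) (use assms in \<open>auto intro: finite_subset[of _ "Pow I"]\<close>)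
  ultimately show ?thesis using n_subsets[OF assms(1)] by simp
qed

lemma card_sym_diff:
  assumes "finite C" "finite D"
  shows "card (sym_diff C D) + 2 * card (C \<inter> D) = card C + card D"
proof -
  have "card C = card (C - D) + card (C \<inter> D)" "card D = card (D - C) + card (C \<inter> D)"
    using card_Diff_subset_Int[of C D] card_Diff_subset_Int[of D C] assms
      card_mono[of C "C \<inter> D"] card_mono[of D "C \<inter> D"] by (auto simp: Int_commute)
  moreover have "card (sym_diff C D) = card (C - D) + card (D - C)"
    using assms by (intro card_Un_disjoint) auto
  ultimately show ?thesis by simp
qed

text \<open>No coordinate vanishes on the whole code and no two coordinates agree on it. The
  coordinates of a uniformly random word are therefore fair and pairwise independent bits, so its
  weight has the first two moments of a binomial distribution with parameters \<open>card R\<close>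
  and 1/2.\<close>

locale separating_code =
  fixes R :: "'a set" and \<K> :: "'a set set"
  assumes fin: "finite R"
    and code: "cube_subgroup R \<K>"
    and covered: "\<And>e. e \<in> R \<Longrightarrow> \<exists>C\<in>\<K>. e \<in> C"
    and separated: "\<And>e f. \<lbrakk>e \<in> R; f \<in> R; e \<noteq> f\<rbrakk> \<Longrightarrow> \<exists>C\<in>\<K>. (e \<in> C) \<noteq> (f \<in> C)"
begin

definition words :: "nat \<Rightarrow> 'a set set" where
  "words k = {C \<in> \<K>. card C = k}"

lemma empty_in: "{} \<in> \<K>" and sym_diff_in: "C \<in> \<K> \<Longrightarrow> D \<in> \<K> \<Longrightarrow> sym_diff C D \<in> \<K>"
  and sub_R: "C \<in> \<K> \<Longrightarrow> C \<subseteq> R"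
  using code by (auto simp: cube_subgroup_def)

lemma finite_code: "finite \<K>"
  using code fin finite_subset[of \<K> "Pow R"] by (simp add: cube_subgroup_def)

lemma finite_word: "C \<in> \<K> \<Longrightarrow> finite C"
  using sub_R fin finite_subset by metis

lemma half:
  assumes "D \<in> \<K>" "\<And>C. C \<in> \<K> \<Longrightarrow> P (sym_diff C D) \<longleftrightarrow> \<not> P C"
  shows "2 * card {C \<in> \<K>. P C} = card \<K>"
proof -
  have inv: "sym_diff (sym_diff C D) D = C" for C by blast
  have "bij_betw (\<lambda>C. sym_diff C D) {C \<in> \<K>. P C} {C \<in> \<K>. \<not> P C}"
    by (rule bij_betw_byWitness[where f' = "\<lambda>C. sym_diff C D"])
      (use assms sym_diff_in inv in \<open>auto simp only: mem_Collect_eq image_subset_iff\<close>)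
  then have "card {C \<in> \<K>. P C} = card {C \<in> \<K>. \<not> P C}" by (rule bij_betw_same_card)
  moreover have "card {C \<in> \<K>. P C} + card {C \<in> \<K>. \<not> P C} = card ({C \<in> \<K>. P C} \<union> {C \<in> \<K>. \<not> P C})"
    using finite_code by (intro card_Un_disjoint[symmetric]) auto
  moreover have "{C \<in> \<K>. P C} \<union> {C \<in> \<K>. \<not> P C} = \<K>" by blast
  ultimately show ?thesis by simp
qed

lemma half_coord:
  assumes "e \<in> R"
  shows "2 * card {C \<in> \<K>. e \<in> C} = card \<K>"
proof -
  obtain D where "D \<in> \<K>" "e \<in> D" using covered[OF assms] by blast
  then show ?thesis by (intro half[of D]) auto
qed

lemma quarter_coords:
  assumes "e \<in> R" "f \<in> R" "e \<noteq> f"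
  shows "4 * card {C \<in> \<K>. e \<in> C \<and> f \<in> C} = card \<K>"
proof -
  obtain D where D: "D \<in> \<K>" "(e \<in> D) \<noteq> (f \<in> D)" using separated[OF assms] by blast
  let ?n = "\<lambda>P. card {C \<in> \<K>. P C}"
  have fin: "finite {C \<in> \<K>. P C}" for P using finite_code by simp
  have "2 * ?n (\<lambda>C. (e \<in> C) \<noteq> (f \<in> C)) = card \<K>"
    by (rule half[OF D(1)]) (use D(2) in auto)
  moreover have "?n (\<lambda>C. (e \<in> C) \<noteq> (f \<in> C)) = ?n (\<lambda>C. e \<in> C \<and> f \<notin> C) + ?n (\<lambda>C. f \<in> C \<and> e \<notin> C)"
    by (subst card_Un_disjoint[symmetric, OF fin fin]) (auto intro!: arg_cong[where f = card])
  moreover have "?n (\<lambda>C. e \<in> C) = ?n (\<lambda>C. e \<in> C \<and> f \<notin> C) + ?n (\<lambda>C. e \<in> C \<and> f \<in> C)"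
    by (subst card_Un_disjoint[symmetric, OF fin fin]) (auto intro!: arg_cong[where f = card])
  moreover have "?n (\<lambda>C. f \<in> C) = ?n (\<lambda>C. f \<in> C \<and> e \<notin> C) + ?n (\<lambda>C. e \<in> C \<and> f \<in> C)"
    by (subst card_Un_disjoint[symmetric, OF fin fin]) (auto intro!: arg_cong[where f = card])
  ultimately show ?thesis using half_coord[OF assms(1)] half_coord[OF assms(2)] by linarith
qed

lemma card_word_eq_sum: "C \<in> \<K> \<Longrightarrow> real (card C) = (\<Sum>e\<in>R. of_bool (e \<in> C))"
  using sub_R fin by (simp add: Int_absorb1)

lemma sum_weight: "(\<Sum>C\<in>\<K>. real (card C)) = real (card R) * card \<K> / 2"
proof -
  have "(\<Sum>C\<in>\<K>. real (card C)) = (\<Sum>C\<in>\<K>. \<Sum>e\<in>R. of_bool (e \<in> C))"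
    by (intro sum.cong refl card_word_eq_sum)
  also have "\<dots> = (\<Sum>e\<in>R. \<Sum>C\<in>\<K>. of_bool (e \<in> C))" by (rule sum.swap)
  also have "\<dots> = (\<Sum>e\<in>R. real (card \<K>) / 2)"
  proof (intro sum.cong refl)
    fix e assume "e \<in> R"
    have "(\<Sum>C\<in>\<K>. of_bool (e \<in> C)) = real (card {C \<in> \<K>. e \<in> C})"
      using finite_code by (simp add: Int_def)
    then show "(\<Sum>C\<in>\<K>. of_bool (e \<in> C)) = real (card \<K>) / 2"
      using half_coord[OF \<open>e \<in> R\<close>] by simp
  qed
  finally show ?thesis by simp
qed

lemma sum_weight_sq: "(\<Sum>C\<in>\<K>. (real (card C))\<^sup>2) = ((real (card R))\<^sup>2 + real (card R)) * card \<K> / 4"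
proof -
  let ?k = "real (card \<K>)"
  have "(\<Sum>C\<in>\<K>. (real (card C))\<^sup>2) = (\<Sum>C\<in>\<K>. \<Sum>e\<in>R. \<Sum>f\<in>R. of_bool (e \<in> C) * of_bool (f \<in> C))"
    by (intro sum.cong refl) (simp only: card_word_eq_sum power2_eq_square sum_product)
  also have "\<dots> = (\<Sum>e\<in>R. \<Sum>C\<in>\<K>. \<Sum>f\<in>R. of_bool (e \<in> C) * of_bool (f \<in> C))" by (rule sum.swap)
  also have "\<dots> = (\<Sum>e\<in>R. \<Sum>f\<in>R. \<Sum>C\<in>\<K>. of_bool (e \<in> C) * of_bool (f \<in> C))"
    by (intro sum.cong refl sum.swap)
  also have "\<dots> = (\<Sum>e\<in>R. \<Sum>f\<in>R. ?k / 4 + (if f = e then ?k / 4 else 0))"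
  proof (intro sum.cong refl)
    fix e f assume ef: "e \<in> R" "f \<in> R"
    have "(\<Sum>C\<in>\<K>. of_bool (e \<in> C) * of_bool (f \<in> C)) = real (card {C \<in> \<K>. e \<in> C \<and> f \<in> C})"
      using finite_code by (simp add: Int_def flip: of_bool_conj)
    then show "(\<Sum>C\<in>\<K>. of_bool (e \<in> C) * of_bool (f \<in> C)) = ?k / 4 + (if f = e then ?k / 4 else 0)"
      using half_coord[OF ef(1)] quarter_coords[OF ef] by (cases "f = e") auto
  qed
  also have "\<dots> = ((real (card R))\<^sup>2 + real (card R)) * ?k / 4"
  proof -
    have "(\<Sum>f\<in>R. ?k / 4 + (if f = e then ?k / 4 else 0)) = card R * (?k / 4) + ?k / 4" if "e \<in> R" for e
      using fin that by (simp only: sum.distrib sum_constant sum.delta) simp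
    then have "(\<Sum>e\<in>R. \<Sum>f\<in>R. ?k / 4 + (if f = e then ?k / 4 else 0)) = (\<Sum>e\<in>R. card R * (?k / 4) + ?k / 4)"
      by (intro sum.cong refl)
    then show ?thesis by (simp add: power2_eq_square algebra_simps)
  qed
  finally show ?thesis .
qed

lemma sum_weight_dist_sq:
  fixes a :: real
  shows "(\<Sum>C\<in>\<K>. (real (card C) - a)\<^sup>2) = card \<K> * (((real (card R))\<^sup>2 + real (card R)) / 4 - a * card R + a\<^sup>2)"
proof -
  have "(\<Sum>C\<in>\<K>. (real (card C) - a)\<^sup>2) = (\<Sum>C\<in>\<K>. (real (card C))\<^sup>2 - 2 * a * card C + a\<^sup>2)"
    by (intro sum.cong refl) (simp add: power2_eq_square algebra_simps)
  also have "\<dots> = (\<Sum>C\<in>\<K>. (real (card C))\<^sup>2) - 2 * a * (\<Sum>C\<in>\<K>. real (card C)) + card \<K> * a\<^sup>2"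
    by (simp add: sum.distrib sum_subtractf sum_distrib_left)
  also have "\<dots> = card \<K> * (((real (card R))\<^sup>2 + real (card R)) / 4 - a * card R + a\<^sup>2)"
    unfolding sum_weight sum_weight_sq by (simp add: field_simps)
  finally show ?thesis .
qed

text \<open>The zero word alone has to fit into the total squared deviation. With m =
  \<open>card R\<close>, the centre (m + 1) / 2 is chosen so that both sides share the factor m +
  1.\<close>

lemma length_less: "card R < card \<K>"
proof -
  let ?m = "real (card R)" and ?a = "(real (card R) + 1) / 2"
  have "(real (card {}) - ?a)\<^sup>2 \<le> (\<Sum>C\<in>\<K>. (real (card C) - ?a)\<^sup>2)"
    using member_le_sum[of "{}" \<K> "\<lambda>C. (real (card C) - ?a)\<^sup>2"] empty_in finite_code by simp
  then have "((?m + 1) / 2)\<^sup>2 \<le> card \<K> * ((?m\<^sup>2 + ?m) / 4 - ?a * ?m + ?a\<^sup>2)"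
    unfolding sum_weight_dist_sq by (simp add: power2_eq_square)
  also have "\<dots> = card \<K> * (?m + 1) / 4" by (simp add: field_simps power2_eq_square)
  finally have "(?m + 1) * (?m + 1) \<le> card \<K> * (?m + 1)" by (simp add: field_simps power2_eq_square)
  then have "?m + 1 \<le> card \<K>" by (rule mult_right_le_imp_le) simp
  then show ?thesis by linarith
qed

text \<open>Adding a fixed odd word exchanges odd and even words, so the odd words are none or
  exactly half.\<close>

lemma odd_words_le: "2 * (card (words 1) + card (words 3)) \<le> card \<K>"
proof (cases "\<exists>D\<in>\<K>. odd (card D)")
  case True
  then obtain D where D: "D \<in> \<K>" "odd (card D)" by blast
  have "odd (card (sym_diff C D)) \<longleftrightarrow> \<not> odd (card C)" if "C \<in> \<K>" for C
  proof -
    have "card (sym_diff C D) + 2 * card (C \<inter> D) = card C + card D"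
      by (rule card_sym_diff[OF finite_word[OF that] finite_word[OF D(1)]])
    then show ?thesis using D(2) by presburger
  qed
  then have "2 * card {C \<in> \<K>. odd (card C)} = card \<K>" by (rule half[OF D(1)])
  moreover have "card (words 1 \<union> words 3) \<le> card {C \<in> \<K>. odd (card C)}"
    using finite_code by (intro card_mono) (auto simp: words_def)
  moreover have "card (words 1 \<union> words 3) = card (words 1) + card (words 3)"
    using finite_code by (intro card_Un_disjoint) (auto simp: words_def)
  ultimately show ?thesis by (metis mult_le_mono2)
next
  case False
  then have "words 1 = {}" "words 3 = {}" by (force simp: words_def)+
  then show ?thesis by simp
qed

text \<open>The complement of a basis of the cube modulo the code is an information set: a word is
  determined by its trace there, and every trace occurs.\<close>

lemma ex_information_set:
  obtains I where "I \<subseteq> R" "bij_betw (\<lambda>C. C \<inter> I) \<K> (Pow I)" "card \<K> = 2 ^ card I"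
proof -
  obtain J where J: "J \<subseteq> R" "independent_mod \<K> J" "spanning_mod R \<K> J"
    using ex_independent_spanning[OF fin code] .
  define I where "I = R - J"
  have "inj_on (\<lambda>C. C \<inter> I) \<K>"
  proof (rule inj_onI)
    fix C D assume CD: "C \<in> \<K>" "D \<in> \<K>" "C \<inter> I = D \<inter> I"
    then have "sym_diff C D \<subseteq> J" using sub_R[of C] sub_R[of D] by (auto simp: I_def)
    then have "sym_diff C D = {}" using J(2) sym_diff_in[OF CD(1,2)] unfolding independent_mod_def by blast
    then show "C = D" by blast
  qed
  moreover have "Pow I \<subseteq> (\<lambda>C. C \<inter> I) ` \<K>"
  proof
    fix Y assume Y: "Y \<in> Pow I"
    then have "Y \<subseteq> R" by (auto simp: I_def)
    then obtain X where X: "X \<subseteq> J" "sym_diff X Y \<in> \<K>" using J(3) unfolding spanning_mod_def by blast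
    then have "Y = sym_diff X Y \<inter> I" using Y by (auto simp: I_def)
    then show "Y \<in> (\<lambda>C. C \<inter> I) ` \<K>" using X(2) by (rule image_eqI)
  qed
  moreover have "(\<lambda>C. C \<inter> I) ` \<K> \<subseteq> Pow I" by auto
  ultimately have bij: "bij_betw (\<lambda>C. C \<inter> I) \<K> (Pow I)" by (simp add: bij_betw_def subset_antisym)
  have I: "I \<subseteq> R" by (auto simp: I_def)
  then have "finite I" using fin finite_subset by blast
  then have "card \<K> = 2 ^ card I" using bij_betw_same_card[OF bij] by (simp add: card_Pow)
  then show ?thesis using that I bij by blast
qed

context
  fixes I assumes I: "I \<subseteq> R" and bij: "bij_betw (\<lambda>C. C \<inter> I) \<K> (Pow I)"
begin

lemma finite_I: "finite I"
  using I fin finite_subset by blast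

lemma trace_inj: "C \<in> \<K> \<Longrightarrow> D \<in> \<K> \<Longrightarrow> C \<inter> I = D \<inter> I \<Longrightarrow> C = D"
  by (rule inj_onD[OF bij_betw_imp_inj_on[OF bij]])

text \<open>A nonzero word has a nonempty trace on the information set, no larger than the word, and
  distinct words have distinct traces.\<close>

lemma light_words_le:
  "card {C \<in> \<K>. card C \<in> {1..k}} \<le> (\<Sum>j = 1..k. card I choose j)"
proof -
  have "card {C \<in> \<K>. card C \<in> {1..k}} = card ((\<lambda>C. C \<inter> I) ` {C \<in> \<K>. card C \<in> {1..k}})"
    by (rule card_image[symmetric], rule inj_on_subset[OF bij_betw_imp_inj_on[OF bij]]) simp
  also have "\<dots> \<le> card {J. J \<subseteq> I \<and> card J \<in> {1..k}}"
  proof (rule card_mono)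
    show "finite {J. J \<subseteq> I \<and> card J \<in> {1..k}}" using finite_I by simp
    show "(\<lambda>C. C \<inter> I) ` {C \<in> \<K>. card C \<in> {1..k}} \<subseteq> {J. J \<subseteq> I \<and> card J \<in> {1..k}}"
    proof clarify
      fix C assume C: "C \<in> \<K>" "card C \<in> {1..k}"
      then have "C \<noteq> {}" by auto
      then have "C \<inter> I \<noteq> {}" using trace_inj[OF C(1) empty_in] by auto
      then have "1 \<le> card (C \<inter> I)" using finite_I by (simp add: Suc_le_eq card_gt_0_iff)
      moreover have "card (C \<inter> I) \<le> card C" using finite_word[OF C(1)] by (simp add: card_mono)
      ultimately show "C \<inter> I \<subseteq> I \<and> card (C \<inter> I) \<in> {1..k}" using C(2) by auto
    qed
  qed
  also have "\<dots> = (\<Sum>j = 1..k. card I choose j)"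
    using finite_I by (intro card_subsets_card_in) auto
  finally show ?thesis .
qed

text \<open>A coordinate \<open>e\<close> outside \<open>I\<close> is the parity of the coordinates
  in some \<open>A \<subseteq> I\<close>. As \<open>e\<close> is neither zero nor a copy of another
  coordinate, \<open>A\<close> has at least two elements, and a word of weight one must be supported
  in \<open>I - A\<close>.\<close>

lemma words_1_le:
  assumes "I \<noteq> R"
  shows "card (words 1) + 2 \<le> card I"
proof -
  obtain e where e: "e \<in> R" "e \<notin> I" using assms I by blast
  \<comment> \<open>The words \<open>c i\<close> are the rows of a generator matrix in systematic
    form.\<close>
  define c where "c i = (THE C. C \<in> \<K> \<and> C \<inter> I = {i})" for i
  have c: "c i \<in> \<K>" "c i \<inter> I = {i}" if "i \<in> I" for i
  proof -
    have "{i} \<in> (\<lambda>C. C \<inter> I) ` \<K>" using bij that by (simp add: bij_betw_def)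
    then obtain C where "C \<in> \<K>" "C \<inter> I = {i}" by (rule_tac imageE) auto
    then have "\<exists>!C. C \<in> \<K> \<and> C \<inter> I = {i}" using trace_inj by (intro ex1I[of _ C]) auto
    from theI'[OF this] show "c i \<in> \<K>" "c i \<inter> I = {i}" by (auto simp: c_def)
  qed
  define A where "A = {i \<in> I. e \<in> c i}"
  have fA: "finite A" using finite_I by (simp add: A_def)
  have *: "e \<in> C \<longleftrightarrow> odd (card (J \<inter> A))" if "finite J" "C \<in> \<K>" "C \<inter> I = J" for C J
    using that
  proof (induction J arbitrary: C)
    case empty
    then have "C = {}" using trace_inj[OF _ empty_in] by auto
    then show ?case by simp
  next
    case (insert i J)
    have i: "i \<in> I" using insert.prems(2) by blast
    have "sym_diff C (c i) \<in> \<K>" using sym_diff_in insert.prems(1) c(1)[OF i] by blast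
    moreover have "sym_diff C (c i) \<inter> I = J"
    proof -
      have "sym_diff C (c i) \<inter> I = sym_diff (C \<inter> I) (c i \<inter> I)" by blast
      also have "\<dots> = J" unfolding insert.prems(2) c(2)[OF i] using insert.hyps(2) by auto
      finally show ?thesis .
    qed
    ultimately have "e \<in> sym_diff C (c i) \<longleftrightarrow> odd (card (J \<inter> A))" by (rule insert.IH)
    moreover have "card (insert i J \<inter> A) = (if i \<in> A then 1 else 0) + card (J \<inter> A)"
      using insert.hyps fA by (simp add: Int_insert_left)
    ultimately show ?case using i by (auto simp: A_def)
  qed
  have eC: "e \<in> C \<longleftrightarrow> odd (card (C \<inter> A))" if "C \<in> \<K>" for C
  proof -
    have "C \<inter> I \<inter> A = C \<inter> A" by (auto simp: A_def)
    then show ?thesis using *[OF _ that refl] finite_I by simp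
  qed
  have "card A \<noteq> 0"
  proof
    assume "card A = 0"
    then have "A = {}" using fA by simp
    then show False using covered[OF e(1)] eC by simp
  qed
  moreover have "card A \<noteq> 1"
  proof
    assume "card A = 1"
    then obtain i where i: "A = {i}" by (auto simp: card_1_singleton_iff)
    then have iI: "i \<in> I" by (auto simp: A_def)
    then obtain C where C: "C \<in> \<K>" "(e \<in> C) \<noteq> (i \<in> C)" using separated[OF e(1), of i] e(2) I by blast
    then show False using eC[OF C(1)] i by (cases "i \<in> C") auto
  qed
  ultimately have "2 \<le> card A" by linarith
  moreover have "card (words 1) \<le> card (I - A)"
  proof -
    have "words 1 \<subseteq> (\<lambda>x. {x}) ` (I - A)"
    proof
      fix C assume "C \<in> words 1"
      then obtain x where x: "C = {x}" "{x} \<in> \<K>" by (auto simp: words_def card_1_singleton_iff)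
      then have "{x} \<inter> I \<noteq> {}" using trace_inj[OF x(2) empty_in] by auto
      then have xI: "x \<in> I" by auto
      then have "c x = {x}" using trace_inj[OF c(1)[OF xI] x(2)] c(2)[OF xI] by auto
      then have "x \<notin> A" using xI e(2) by (auto simp: A_def)
      then show "C \<in> (\<lambda>x. {x}) ` (I - A)" using x xI by blast
    qed
    then have "card (words 1) \<le> card ((\<lambda>x. {x}) ` (I - A))" using finite_I by (intro card_mono) auto
    also have "\<dots> \<le> card (I - A)" using finite_I by (intro card_image_le) auto
    finally show ?thesis .
  qed
  moreover have "card (I - A) + card A = card I"
    using card_Diff_subset[OF fA, of I] card_mono[OF finite_I, of A] by (auto simp: A_def)
  ultimately show ?thesis by linarith
qed

lemma code_eq_Pow:
  assumes "I = R" shows "\<K> = Pow R"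
proof -
  have "(\<lambda>C. C \<inter> I) ` \<K> = \<K>" using sub_R assms by (force simp: Int_absorb2)
  then show ?thesis using bij assms by (simp add: bij_betw_def)
qed

end

end

text \<open>The values on at most two edges are forced by the subgraphs of a triangle. The values
  \<open>\<plusminus>1/100\<close> separate \<open>C\<^sub>4\<close>, which is what \<open>\<kappa>\<close> recognises, from the forests with four edges; with
  \<open>0\<close> instead, these forests and \<open>K\<^sub>4\<close> minus an edge would also attain the extreme eigenvalue.\<close>

definition phi :: "('a set \<Rightarrow> bool) \<Rightarrow> 'a set \<Rightarrow> real" where
  "phi \<kappa> C = (if card C = 0 then 1 else if card C = 1 then -5/7 else if card C = 2 then -1/7
    else if card C = 3 then 3/28 else if card C = 4 then (if \<kappa> C then -1/100 else 1/100) else 0)"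

section \<open>Sums of \<open>phi\<close> over separating codes\<close>

lemma small_binomials:
  "2 choose 3 = 0" "2 choose 4 = 0" "3 choose 2 = 3" "3 choose 4 = 0" "4 choose 2 = 6" "4 choose 3 = 4"
  "5 choose 2 = 10" "5 choose 3 = 10"
  by (simp_all add: eval_nat_numeral)

text \<open>Equality holds at r = 5, which is the origin of 103/32. The slack that this leaves in
  \<open>sum_phi_odd\<close> absorbs the words of weight four and the margin 1/1600.\<close>

lemma cubic_le_power:
  assumes "5 \<le> r"
  shows "32 * (28 + 3 * (r + (r choose 2) + (r choose 3))) \<le> 103 * 2 ^ r"
  using assms
proof (induction r rule: dec_induct)
  case base
  show ?case by (simp add: small_binomials)
next
  case (step r)
  have "Suc r choose 2 = r + (r choose 2)" "Suc r choose 3 = (r choose 2) + (r choose 3)"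
    by (simp_all add: eval_nat_numeral)
  then show ?case using step.IH by simp
qed

text \<open>Equality holds at r = 5 again. The summand 56 accounts for the zero word, whose value 1
  becomes 56 when the denominators 7 and 8 are cleared.\<close>

lemma quadratic_le_power:
  assumes "5 \<le> r"
  shows "8 * (5 * r + (r choose 2)) \<le> 7 * 2 ^ r + 56"
  using assms
proof (induction r rule: dec_induct)
  case base
  show ?case by (simp add: small_binomials)
next
  case (step r)
  have "Suc r choose 2 = r + (r choose 2)" by (simp add: eval_nat_numeral)
  moreover have "8 * (5 + r) \<le> 7 * 2 ^ r"
  proof -
    obtain k where r: "r = 5 + k" using le_Suc_ex[OF step.hyps(1)] by blast
    have "k + 1 \<le> 2 ^ k" using less_exp[of k] unfolding Suc_eq_plus1[symmetric] by (rule Suc_leI)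
    moreover have "(2::nat) ^ r = 32 * 2 ^ k" unfolding r by (simp add: power_add)
    ultimately show ?thesis unfolding r by simp
  qed
  ultimately show ?case using step.IH by simp
qed

context separating_code
begin

lemma finite_words [simp]: "finite (words k)"
  using finite_code by (simp add: words_def)

lemma words_0: "words 0 = {{}}"
  using finite_word empty_in by (auto simp: words_def)

lemma card_words_le: "card (words k) \<le> card \<K>"
  using finite_code by (intro card_mono) (auto simp: words_def)

lemma words_empty:
  assumes "card R < k" shows "words k = {}"
proof -
  have "card C < k" if "C \<in> \<K>" for C
    using card_mono[OF fin sub_R[OF that]] assms by linarith
  then show ?thesis by (auto simp: words_def)
qed

lemma sum_by_weight:
  fixes f :: "nat \<Rightarrow> real"
  shows "(\<Sum>C\<in>\<K>. f (card C)) = (\<Sum>k\<le>card R. f k * card (words k))"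
proof -
  have "(\<Sum>k\<in>{..card R}. \<Sum>C\<in>{C \<in> \<K>. card C = k}. f (card C)) = (\<Sum>C\<in>\<K>. f (card C))"
    using finite_code sub_R fin by (intro sum.group) (auto intro: card_mono)
  moreover have "(\<Sum>C\<in>{C \<in> \<K>. card C = k}. f (card C)) = f k * card (words k)" for k
    by (simp add: words_def)
  ultimately show ?thesis by (simp only:)
qed

lemma sum_phi:
  "(\<Sum>C\<in>\<K>. phi \<kappa> C) = 1 - 5/7 * card (words 1) - 1/7 * card (words 2) + 3/28 * card (words 3)
    + (real (card {C \<in> words 4. \<not> \<kappa> C}) - card {C \<in> words 4. \<kappa> C}) / 100"
proof -
  have count: "(\<Sum>C\<in>\<K>. of_bool (P C)) = real (card {C \<in> \<K>. P C})" for P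
    using finite_code by (simp add: Int_def)
  have "(\<Sum>C\<in>\<K>. phi \<kappa> C) = (\<Sum>C\<in>\<K>. of_bool (card C = 0) - 5/7 * of_bool (card C = 1) - 1/7 * of_bool (card C = 2)
      + 3/28 * of_bool (card C = 3) + 1/100 * of_bool (card C = 4 \<and> \<not> \<kappa> C) - 1/100 * of_bool (card C = 4 \<and> \<kappa> C))"
    by (intro sum.cong refl) (simp add: phi_def)
  also have "\<dots> = real (card (words 0)) - 5/7 * card (words 1) - 1/7 * card (words 2) + 3/28 * card (words 3)
      + 1/100 * card {C \<in> words 4. \<not> \<kappa> C} - 1/100 * card {C \<in> words 4. \<kappa> C}"
    unfolding sum.distrib sum_subtractf sum_distrib_left[symmetric] count words_def by (simp add: conj_assoc)
  finally show ?thesis by (simp add: words_0 field_simps)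
qed

lemma sum_phi_bounds:
  defines "q \<equiv> 1 - 5/7 * card (words 1) - 1/7 * card (words 2) + 3/28 * card (words 3)"
  shows "(\<Sum>C\<in>\<K>. phi \<kappa> C) \<le> q + card (words 4) / 100"
    and "q - card (words 4) / 100 \<le> (\<Sum>C\<in>\<K>. phi \<kappa> C)"
proof -
  have "card {C \<in> words 4. \<not> \<kappa> C} \<le> card (words 4)" "card {C \<in> words 4. \<kappa> C} \<le> card (words 4)"
    by (auto intro: card_mono)
  note le = this[THEN of_nat_mono, where 'a = real]
  show "(\<Sum>C\<in>\<K>. phi \<kappa> C) \<le> q + card (words 4) / 100"
    using le unfolding sum_phi q_def by (simp add: field_simps)
  show "q - card (words 4) / 100 \<le> (\<Sum>C\<in>\<K>. phi \<kappa> C)"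
    using le unfolding sum_phi q_def by (simp add: field_simps)
qed

context
  fixes I assumes I: "I \<subseteq> R" and bij: "bij_betw (\<lambda>C. C \<inter> I) \<K> (Pow I)"
begin

lemma card_words_1: "card (words 1) \<le> card I"
  using light_words_le[OF I bij, of 1] by (simp add: words_def)

lemma card_words_12: "card (words 1) + card (words 2) \<le> card I + (card I choose 2)"
proof -
  have "{C \<in> \<K>. card C \<in> {1..2}} = words 1 \<union> words 2" by (auto simp: words_def)
  moreover have "card (words 1 \<union> words 2) = card (words 1) + card (words 2)"
    by (intro card_Un_disjoint finite_words) (auto simp: words_def)
  ultimately show ?thesis
    using light_words_le[OF I bij, of 2] by (simp add: numeral_2_eq_2)
qed

lemma card_words_3: "card (words 3) \<le> card I + (card I choose 2) + (card I choose 3)"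
proof -
  have "card (words 3) \<le> card {C \<in> \<K>. card C \<in> {1..3}}"
    using finite_code by (intro card_mono) (auto simp: words_def)
  also have "\<dots> \<le> card I + (card I choose 2) + (card I choose 3)"
    using light_words_le[OF I bij, of 3] by (simp add: numeral_3_eq_3 numeral_2_eq_2)
  finally show ?thesis .
qed

end

text \<open>The only word of weight four meets every word evenly: otherwise its sum with another
  nonzero word would not have weight two or three.\<close>

lemma words_length_5_dim_3:
  assumes "card R = 5" "card \<K> = 8" and \<kappa>: "\<forall>C\<in>\<K>. (\<forall>D\<in>\<K>. even (card (C \<inter> D))) \<longrightarrow> \<kappa> C"
  shows "card (words 1) = 0" "card (words 2) = 2" "card (words 3) = 4" "{C \<in> words 4. \<not> \<kappa> C} = {}" "card (words 4) = 1"
proof -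
  have upto: "{..5::nat} = {0, 1, 2, 3, 4, 5}" by auto
  have w0: "card (words 0) = 1" by (simp add: words_0)
  have e1: "real (card (words 0) + card (words 1) + card (words 2) + card (words 3) + card (words 4) + card (words 5)) = real 8"
    using sum_by_weight[of "\<lambda>_. 1"] assms by (simp add: upto)
  have e2: "real (card (words 1) + 2 * card (words 2) + 3 * card (words 3) + 4 * card (words 4) + 5 * card (words 5)) = real 20"
    using sum_by_weight[of real] sum_weight assms by (simp add: upto)
  \<comment> \<open>Around the centre 3 the zero word uses up 9 of the total 12. The remaining 3
    leaves no room for weights one and five, which cost 4 each.\<close>
  have e3: "real (9 * card (words 0) + 4 * card (words 1) + card (words 2) + card (words 4) + 4 * card (words 5)) = real 12"
    using sum_by_weight[of "\<lambda>k. (real k - 3)\<^sup>2"] sum_weight_dist_sq[of 3] assms by (simp add: upto power2_eq_square)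
  have w: "card (words 1) = 0 \<and> card (words 2) = 2 \<and> card (words 3) = 4 \<and> card (words 4) = 1 \<and> card (words 5) = 0"
  proof -
    have "b1 = 0 \<and> b2 = 2 \<and> b3 = 4 \<and> b4 = 1 \<and> b5 = 0"
      if "b0 = 1" "b0 + b1 + b2 + b3 + b4 + b5 = 8" "b1 + 2 * b2 + 3 * b3 + 4 * b4 + 5 * b5 = 20"
        "9 * b0 + 4 * b1 + b2 + b4 + 4 * b5 = 12" for b0 b1 b2 b3 b4 b5 :: nat
    proof -
      have b: "b1 = 0" "b5 = 0" using that(1,4) by linarith+
      then have "b2 + b4 = 3" "b2 + b3 + b4 = 7" "2 * b2 + 3 * b3 + 4 * b4 = 20" using that by linarith+
      then have "b3 = 4" "b4 = 1" "b2 = 2" by linarith+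
      then show ?thesis using b by blast
    qed
    from this[OF w0 e1[unfolded of_nat_eq_iff] e2[unfolded of_nat_eq_iff] e3[unfolded of_nat_eq_iff]] show ?thesis .
  qed
  then show "card (words 1) = 0" "card (words 2) = 2" "card (words 3) = 4" "card (words 4) = 1" by auto
  obtain C where C: "words 4 = {C}" using w by (auto simp: card_1_singleton_iff)
  have CK: "C \<in> \<K>" "card C = 4" using C by (auto simp: words_def)
  have wt: "card D \<in> {2, 3}" if D: "D \<in> \<K>" "D \<noteq> {}" "D \<noteq> C" for D
  proof -
    have "card D \<le> 5" using sub_R[OF D(1)] fin assms(1) card_mono by metis
    moreover have "card D \<noteq> 0" using D finite_word by auto
    moreover have "words 1 = {}" "words 5 = {}" using w by simp_all
    then have "card D \<noteq> 1" "card D \<noteq> 5" using D(1) by (auto simp: words_def)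
    moreover have "card D \<noteq> 4" using C D by (auto simp: words_def)
    ultimately show ?thesis by auto
  qed
  have "even (card (C \<inter> D))" if D: "D \<in> \<K>" for D
  proof (cases "D = {} \<or> D = C")
    case True
    then show ?thesis using CK by auto
  next
    case False
    then have "sym_diff C D \<noteq> {}" "sym_diff C D \<noteq> C" by auto
    then have "card (sym_diff C D) \<in> {2, 3}" using wt sym_diff_in CK(1) D by blast
    moreover have "card D \<in> {2, 3}" using wt D False by blast
    moreover have "card (sym_diff C D) + 2 * card (C \<inter> D) = 4 + card D"
      using card_sym_diff[of C D] finite_word CK D by simp
    ultimately have "card (C \<inter> D) = 2" by auto
    then show ?thesis by simp
  qed
  then show "{C \<in> words 4. \<not> \<kappa> C} = {}" using C \<kappa> CK(1) by auto
qed

text \<open>The sign in \<open>eig\<close> turns the lower bound -1/7 into an upper bound for odd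
  \<open>card R\<close>. From dimension five on, counting light words suffices; in dimension four
  the odd words are at most half; below that, \<open>length_less\<close> leaves few lengths, settled
  by moments unless the code is the full cube.\<close>

lemma sum_phi_odd:
  assumes odd: "odd (card R)" and \<kappa>: "\<forall>C\<in>\<K>. (\<forall>D\<in>\<K>. even (card (C \<inter> D))) \<longrightarrow> \<kappa> C"
  shows "(\<Sum>C\<in>\<K>. phi \<kappa> C) \<le> card \<K> / 7" (is "?Q \<le> _")
    and "4 \<le> card R \<Longrightarrow> (\<Sum>C\<in>\<K>. phi \<kappa> C) \<le> card \<K> / 7 - card \<K> / 1600"
proof -
  obtain I where I: "I \<subseteq> R" "bij_betw (\<lambda>C. C \<inter> I) \<K> (Pow I)" and cK: "card \<K> = 2 ^ card I"
    using ex_information_set by blast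
  let ?N = "real (card \<K>)"
  have rm: "card I \<le> card R" using I(1) fin card_mono by blast
  have ub: "?Q \<le> 1 - 5/7 * card (words 1) - 1/7 * card (words 2) + 3/28 * card (words 3) + card (words 4) / 100"
    by (rule sum_phi_bounds)
  have w4: "real (card (words 4)) \<le> real (card \<K>)" unfolding of_nat_le_iff by (rule card_words_le)
  have "?Q \<le> ?N / 7 \<and> (4 \<le> card R \<longrightarrow> ?Q \<le> ?N / 7 - ?N / 1600)"
  proof (cases "5 \<le> card I")
    case True
    have "32 * (28 + 3 * card (words 3)) \<le> 32 * (28 + 3 * (card I + (card I choose 2) + (card I choose 3)))"
      using card_words_3[OF I] by simp
    also have "\<dots> \<le> 103 * card \<K>"
      using cubic_le_power[OF True] by (simp add: cK)
    finally have "real (32 * (28 + 3 * card (words 3))) \<le> real (103 * card \<K>)" unfolding of_nat_le_iff .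
    then have "28 + 3 * real (card (words 3)) \<le> 103 / 32 * ?N" by simp
    moreover have "0 \<le> real (card (words 1))" "0 \<le> real (card (words 2))" "0 \<le> ?N" by simp_all
    ultimately have "?Q \<le> ?N / 7 - ?N / 1600" using ub w4 by argo
    then show ?thesis by simp
  next
    case False
    then consider "card I = 4" | "card I = 3" | "card I = 2" | "card I \<le> 1" by linarith
    then show ?thesis
    proof cases
      case 1
      then have "card \<K> = 16" using cK by simp
      moreover from this have "real (card (words 1) + card (words 3)) \<le> real 8"
        unfolding of_nat_le_iff using odd_words_le by simp
      ultimately have "?Q \<le> ?N / 7 - ?N / 1600" using ub w4 by linarith
      then show ?thesis by linarith
    next
      case 2
      then have K8: "card \<K> = 8" using cK by simp
      then have "card R < 8" using length_less by simp
      then have "card R = 3 \<or> card R = 5 \<or> card R = 7" using odd rm 2 by presburger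
      then show ?thesis
      proof (elim disjE)
        assume R: "card R = 3"
        then have "I = R" using I(1) 2 fin by (simp add: card_subset_eq)
        then have "\<K> = Pow R" by (rule code_eq_Pow[OF I])
        then have "words k = {C. C \<subseteq> R \<and> card C = k}" for k unfolding words_def by blast
        then have "card (words k) = 3 choose k" for k using n_subsets[OF fin, of k] R by simp
        then show ?thesis using ub K8 R by (simp add: small_binomials)
      next
        assume R: "card R = 5"
        \<comment> \<open>This is the weight distribution of the cuts of K_4 minus an edge. As 1 -
          2/7 + 4 * 3/28 = 8/7 is the extreme value for 8 words, only the value -1/100 of the word
          of weight four gives a margin.\<close>
        have "?Q = 8/7 - 1/100"
        proof -
          note w = words_length_5_dim_3[OF R K8 \<kappa>]
          have all: "{C \<in> words 4. \<kappa> C} = words 4" using w(4) by blast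
          show ?thesis unfolding sum_phi all w by simp
        qed
        then show ?thesis using K8 by simp
      next
        assume R: "card R = 7"
        have upto: "{..7::nat} = {0, 1, 2, 3, 4, 5, 6, 7}" by auto
        \<comment> \<open>At length seven the zero word uses up the whole squared deviation 16 from
          4, so all other words have weight four: this is the simplex code.\<close>
        have "real (9 * card (words 1) + 4 * card (words 2) + card (words 3) + card (words 5)
            + 4 * card (words 6) + 9 * card (words 7)) = real 0"
          using sum_by_weight[of "\<lambda>k. (real k - 4)\<^sup>2"] sum_weight_dist_sq[of 4] K8 R
          by (simp add: upto power2_eq_square words_0)
        then have "card (words 3) = 0" unfolding of_nat_eq_iff by simp
        then show ?thesis using ub w4 K8 by simp
      qed
    next
      case 3
      then have K4: "card \<K> = 4" using cK by simp
      \<comment> \<open>This is the code of a triangle: three words of weight two, and the bound 4/7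
        is attained.\<close>
      then have R: "card R = 3" using odd rm 3 length_less by presburger
      have upto: "{..3::nat} = {0, 1, 2, 3}" by auto
      have "real (card (words 0)) + card (words 1) + card (words 2) + card (words 3) = 4"
        using sum_by_weight[of "\<lambda>_. 1"] K4 R by (simp add: upto)
      moreover have "4 * real (card (words 0)) + card (words 1) + card (words 3) = 4"
        using sum_by_weight[of "\<lambda>k. (real k - 2)\<^sup>2"] sum_weight_dist_sq[of 2] K4 R by (simp add: upto power2_eq_square)
      moreover have "words 4 = {}" by (rule words_empty) (simp add: R)
      ultimately show ?thesis using ub K4 R by (simp add: words_0)
    next
      case 4
      have "card \<K> \<le> 2" unfolding cK using power_increasing[OF 4, of "2::nat"] by simp
      then have R: "card R = 1" "card \<K> = 2" using odd length_less by (cases "card R"; simp)+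
      have upto: "{..1::nat} = {0, 1}" by auto
      have "real (card (words 0)) + card (words 1) = 2"
        using sum_by_weight[of "\<lambda>_. 1"] R by (simp add: upto)
      moreover have "words 3 = {}" "words 4 = {}" by (rule words_empty; simp add: R)+
      ultimately show ?thesis using ub R by (simp add: words_0)
    qed
  qed
  then show "?Q \<le> ?N / 7" "4 \<le> card R \<Longrightarrow> ?Q \<le> ?N / 7 - ?N / 1600" by auto
qed

text \<open>If the information set is all of \<open>R\<close>, the code is the full cube, as for a
  forest; two edges attain the bound. Otherwise \<open>words_1_le\<close> saves on the words of
  weight one, which have the most negative value.\<close>

lemma sum_phi_even:
  assumes even: "even (card R)" and "R \<noteq> {}" and \<kappa>: "\<forall>C\<in>\<K>. \<kappa> C \<longrightarrow> (\<forall>D\<in>\<K>. even (card (C \<inter> D)))"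
  shows "- (card \<K> / 7) \<le> (\<Sum>C\<in>\<K>. phi \<kappa> C)" (is "_ \<le> ?Q")
    and "4 \<le> card R \<Longrightarrow> - (card \<K> / 7) + card \<K> / 1600 \<le> (\<Sum>C\<in>\<K>. phi \<kappa> C)"
proof -
  obtain I where I: "I \<subseteq> R" "bij_betw (\<lambda>C. C \<inter> I) \<K> (Pow I)" and cK: "card \<K> = 2 ^ card I"
    using ex_information_set by blast
  let ?N = "real (card \<K>)"
  have rm: "card I \<le> card R" using I(1) fin card_mono by blast
  have "card R \<noteq> 0" using fin \<open>R \<noteq> {}\<close> by simp
  then have m2: "2 \<le> card R" using even by presburger
  have lb: "1 - 5/7 * card (words 1) - 1/7 * card (words 2) + 3/28 * card (words 3) - card (words 4) / 100 \<le> ?Q"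
    by (rule sum_phi_bounds)
  have w4: "real (card (words 4)) \<le> real (card \<K>)" unfolding of_nat_le_iff by (rule card_words_le)
  have w12: "card (words 1) + card (words 2) \<le> card I + (card I choose 2)" by (rule card_words_12[OF I])
  have "- (?N / 7) \<le> ?Q \<and> (4 \<le> card R \<longrightarrow> - (?N / 7) + ?N / 1600 \<le> ?Q)"
  proof (cases "5 \<le> card I")
    case True
    have "5 * card (words 1) + card (words 2) \<le> 5 * card I + (card I choose 2)"
      using w12 card_words_1[OF I] by linarith
    then have "8 * (5 * card (words 1) + card (words 2)) \<le> 8 * (5 * card I + (card I choose 2))"
      by (rule mult_le_mono2)
    also have "\<dots> \<le> 7 * card \<K> + 56"
      using quadratic_le_power[OF True] by (simp add: cK)
    finally have "real (8 * (5 * card (words 1) + card (words 2))) \<le> real (7 * card \<K> + 56)" unfolding of_nat_le_iff .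
    then have "40 * real (card (words 1)) + 8 * real (card (words 2)) \<le> 7 * ?N + 56" by simp
    moreover have "0 \<le> real (card (words 3))" "0 \<le> ?N" by simp_all
    ultimately have "- (?N / 7) + ?N / 1600 \<le> ?Q" using lb w4 by argo
    then show ?thesis by simp
  next
    case r4: False
    show ?thesis
    proof (cases "I = R")
      case True
      then have "card R = 2 \<or> card R = 4" using r4 even m2 by presburger
      have "\<K> = Pow R" by (rule code_eq_Pow[OF I True])
      then have "words k = {C. C \<subseteq> R \<and> card C = k}" for k unfolding words_def by blast
      then have cw: "card (words k) = card R choose k" for k using n_subsets[OF fin, of k] by simp
      show ?thesis
        using \<open>card R = 2 \<or> card R = 4\<close>
      proof
        assume R: "card R = 2"
        then show ?thesis using lb cw cK True by (simp add: small_binomials)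
      next
        assume R: "card R = 4"
        have no: "{C \<in> words 4. \<kappa> C} = {}"
        proof -
          have False if "C \<in> words 4" "\<kappa> C" for C
          proof -
            have C: "C \<in> \<K>" "card C = 4" using that by (auto simp: words_def)
            then obtain e where e: "e \<in> C" by fastforce
            then have "{e} \<in> \<K>" using sub_R[OF C(1)] \<open>\<K> = Pow R\<close> by auto
            then have "even (card (C \<inter> {e}))" using \<kappa> C(1) that(2) by blast
            then show False using e by simp
          qed
          then show ?thesis by blast
        qed
        then have all: "{C \<in> words 4. \<not> \<kappa> C} = words 4" by blast
        \<comment> \<open>As 1 - 20/7 - 6/7 + 3/7 = -16/7 is the extreme value for 16 words, the
          margin is exactly the value 1/100 of the word of weight four. Divided by 16 it is the
          1/1600 of the statement.\<close>
        have "?Q = - (16 / 7) + 1/100"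
          unfolding sum_phi no all using cw R by (simp add: small_binomials)
        then show ?thesis using cK R True by simp
      qed
    next
      case False
      have w1: "real (card (words 1) + 2) \<le> real (card I)"
        unfolding of_nat_le_iff by (rule words_1_le[OF I False])
      have "card I < card R" using False I(1) fin by (simp add: psubset_card_mono psubset_eq)
      then have "card I \<noteq> 2" using length_less even unfolding cK by auto
      then consider "card I = 3" | "card I = 4" using r4 w1 by linarith
      then show ?thesis
      proof cases
        case 1
        then have "card \<K> = 8" "real (card (words 1) + card (words 2)) \<le> real 6"
          unfolding of_nat_le_iff using cK w12 by (simp_all add: small_binomials)
        then have "- (?N / 7) + ?N / 1600 \<le> ?Q" using lb w4 w1 1 by linarith
        then show ?thesis by linarith
      next
        case 2
        then have "card \<K> = 16" "real (card (words 1) + card (words 2)) \<le> real 10"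
          unfolding of_nat_le_iff using cK w12 by (simp_all add: small_binomials)
        then have "- (?N / 7) + ?N / 1600 \<le> ?Q" using lb w4 w1 2 by linarith
        then show ?thesis by linarith
      qed
    qed
  qed
  then show "- (?N / 7) \<le> ?Q" "4 \<le> card R \<Longrightarrow> - (?N / 7) + ?N / 1600 \<le> ?Q" by auto
qed

end

subsection \<open>The eigenvalues of the cut operator\<close>

text \<open>Orthogonality to all cuts, that is, evenness of all degrees. In this form, for a subset
  of \<open>R\<close>, it depends only on the traces of the cuts on \<open>R\<close>, as the
  hypotheses on \<kappa> require.\<close>

definition even_graph :: "nat \<Rightarrow> graph \<Rightarrow> bool" where
  "even_graph n C \<longleftrightarrow> (\<forall>U. U \<subseteq> {1..n} \<longrightarrow> even (card (C \<inter> cut_edges n U)))"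

definition eig :: "nat \<Rightarrow> graph \<Rightarrow> real" where
  "eig n R = chi (K n) R * (\<Sum>U\<in>Pow {1..n}. phi (even_graph n) (R \<inter> cut_edges n U)) / 2 ^ n"

lemma cut_sym_diff: "cut_edges n (sym_diff U W) = sym_diff (cut_edges n U) (cut_edges n W)"
proof (rule set_eqI)
  fix e
  show "e \<in> cut_edges n (sym_diff U W) \<longleftrightarrow> e \<in> sym_diff (cut_edges n U) (cut_edges n W)"
  proof (cases "e \<in> K n")
    case True
    then obtain a b where "e = {a, b}" "a \<noteq> b" using K_E by metis
    then show ?thesis using True by (auto simp: cut_edges_def odd_card_pair_Int)
  qed (simp add: cut_edges_def)
qed

lemma cut_empty [simp]: "cut_edges n {} = {}"
  by (simp add: cut_edges_def)

lemma singleton_cut: "e \<in> K n \<Longrightarrow> e \<in> cut_edges n {x} \<longleftrightarrow> x \<in> e"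
  by (auto simp: cut_edges_def Int_insert_right)

lemma cut_code: "cube_subgroup R ((\<lambda>U. R \<inter> cut_edges n U) ` Pow {1..n})"
  unfolding cube_subgroup_def
proof (intro conjI ballI)
  show "{} \<in> (\<lambda>U. R \<inter> cut_edges n U) ` Pow {1..n}" by (rule image_eqI[of _ _ "{}"]) auto
  fix x y assume "x \<in> (\<lambda>U. R \<inter> cut_edges n U) ` Pow {1..n}" "y \<in> (\<lambda>U. R \<inter> cut_edges n U) ` Pow {1..n}"
  then obtain U W where UW: "U \<subseteq> {1..n}" "W \<subseteq> {1..n}" "x = R \<inter> cut_edges n U" "y = R \<inter> cut_edges n W" by blast
  have "sym_diff x y = R \<inter> cut_edges n (sym_diff U W)" unfolding cut_sym_diff UW(3,4) by blast
  then show "sym_diff x y \<in> (\<lambda>U. R \<inter> cut_edges n U) ` Pow {1..n}" using UW(1,2) by blast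
qed auto

text \<open>Star cuts suffice: every edge has an end, and of two distinct edges one has an end that
  the other lacks.\<close>

lemma separating_cut_code:
  assumes "R \<subseteq> K n"
  shows "separating_code R ((\<lambda>U. R \<inter> cut_edges n U) ` Pow {1..n})"
proof
  show "finite R" using assms finite_K finite_subset by blast
  show "cube_subgroup R ((\<lambda>U. R \<inter> cut_edges n U) ` Pow {1..n})" by (rule cut_code)
  have sub: "e \<subseteq> {1..n}" if "e \<in> R" for e using assms that by (auto simp: K_def)
  show "\<exists>C\<in>(\<lambda>U. R \<inter> cut_edges n U) ` Pow {1..n}. e \<in> C" if e: "e \<in> R" for e
  proof -
    have "e \<in> K n" using e assms by blast
    then obtain a b where "e = {a, b}" by (rule K_E)
    then have "e \<in> R \<inter> cut_edges n {a}" "{a} \<in> Pow {1..n}" using e singleton_cut[OF \<open>e \<in> K n\<close>] sub[OF e] by auto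
    then show ?thesis by (intro bexI[OF _ imageI])
  qed
  show "\<exists>C\<in>(\<lambda>U. R \<inter> cut_edges n U) ` Pow {1..n}. (e \<in> C) \<noteq> (f \<in> C)" if ef: "e \<in> R" "f \<in> R" "e \<noteq> f" for e f
  proof -
    have K: "e \<in> K n" "f \<in> K n" using ef assms by auto
    obtain x y where x: "x \<in> e" "x \<notin> f" by (rule distinct_edges_E[OF K ef(3)])
    then have "(e \<in> R \<inter> cut_edges n {x}) \<noteq> (f \<in> R \<inter> cut_edges n {x})" "{x} \<in> Pow {1..n}"
      using ef singleton_cut[OF K(1)] singleton_cut[OF K(2)] sub[OF ef(1)] by auto
    then show ?thesis by (intro bexI[OF _ imageI])
  qed
qed

text \<open>A homomorphism from a cube onto a subgroup \<open>S\<close> has fibres of equal size.\<close>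

lemma sum_hom:
  fixes g :: "'b set \<Rightarrow> real"
  assumes "finite V" and hom: "\<And>U W. h (sym_diff U W) = sym_diff (h U) (h W)"
  shows "card (h ` Pow V) * (\<Sum>U\<in>Pow V. g (h U)) = 2 ^ card V * (\<Sum>C\<in>h ` Pow V. g C)"
proof -
  let ?S = "h ` Pow V"
  have "(\<Sum>U\<in>Pow V. g (sym_diff (h U) C)) = (\<Sum>U\<in>Pow V. g (h U))" if C: "C \<in> ?S" for C
  proof -
    obtain W where "W \<subseteq> V" "C = h W" using C by blast
    then show ?thesis using sum_shift[of W V "\<lambda>U. g (h U)"] by (simp add: hom)
  qed
  then have "card ?S * (\<Sum>U\<in>Pow V. g (h U)) = (\<Sum>C\<in>?S. \<Sum>U\<in>Pow V. g (sym_diff (h U) C))"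
    by simp
  also have "\<dots> = (\<Sum>U\<in>Pow V. \<Sum>C\<in>?S. g (sym_diff (h U) C))" by (rule sum.swap)
  also have "\<dots> = (\<Sum>U\<in>Pow V. \<Sum>C\<in>?S. g C)"
  proof (rule sum.cong[OF refl])
    fix U assume U: "U \<in> Pow V"
    have mem: "sym_diff (h U) C \<in> ?S" if C: "C \<in> ?S" for C
    proof -
      obtain W where W: "W \<subseteq> V" "C = h W" using C by blast
      then have "sym_diff (h U) C = h (sym_diff U W)" by (simp add: hom)
      moreover have "sym_diff U W \<in> Pow V" using U W(1) by auto
      ultimately show ?thesis by (rule image_eqI)
    qed
    have inv: "sym_diff (h U) (sym_diff (h U) C) = C" for C by blast
    show "(\<Sum>C\<in>?S. g (sym_diff (h U) C)) = (\<Sum>C\<in>?S. g C)"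
      by (rule sum.reindex_bij_witness[of _ "sym_diff (h U)" "sym_diff (h U)"]) (rule inv refl | erule mem)+
  qed
  also have "\<dots> = 2 ^ card V * (\<Sum>C\<in>?S. g C)" using assms(1) by (simp add: card_Pow)
  finally show ?thesis .
qed

lemma chi_K: "R \<subseteq> K n \<Longrightarrow> chi (K n) R = (-1) ^ card R"
  by (simp add: chi_eq_power Int_absorb1)

lemma eig_empty: "eig n {} = 1"
  by (simp add: eig_def phi_def card_Pow)

text \<open>\<open>sum_hom\<close> turns the average over vertex sets into an average over the code
  of traces, where the parity of \<open>card R\<close> selects the bound to use.\<close>

lemma eig_lower:
  assumes R: "R \<subseteq> K n" "R \<noteq> {}"
  shows "-1/7 \<le> eig n R" "4 \<le> card R \<Longrightarrow> -1/7 + 1/1600 \<le> eig n R"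
proof -
  let ?\<K> = "(\<lambda>U. R \<inter> cut_edges n U) ` Pow {1..n}"
  interpret separating_code R ?\<K> by (rule separating_cut_code[OF R(1)])
  have N: "real (card ?\<K>) > 0" using empty_in finite_code by (auto simp: card_gt_0_iff)
  have \<kappa>: "even_graph n C \<longleftrightarrow> (\<forall>D\<in>?\<K>. even (card (C \<inter> D)))" if "C \<in> ?\<K>" for C
  proof -
    have "C \<subseteq> R" using that by auto
    then have "C \<inter> (R \<inter> cut_edges n U) = C \<inter> cut_edges n U" for U by blast
    then show ?thesis by (auto simp: even_graph_def)
  qed
  have "card ?\<K> * (\<Sum>U\<in>Pow {1..n}. phi (even_graph n) (R \<inter> cut_edges n U)) = 2 ^ n * (\<Sum>C\<in>?\<K>. phi (even_graph n) C)"
    using sum_hom[of "{1..n}" "\<lambda>U. R \<inter> cut_edges n U" "phi (even_graph n)"] by (simp add: cut_sym_diff Int_Un_distrib Diff_Int_distrib)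
  moreover have "s * (a / 2 ^ n) = s * (b / k)" if "k * a = 2 ^ n * b" "k > 0" for a b k s :: real
    using that by (simp add: field_simps)
  ultimately have eig: "eig n R = (-1) ^ card R * ((\<Sum>C\<in>?\<K>. phi (even_graph n) C) / card ?\<K>)"
    unfolding eig_def chi_K[OF R(1)] times_divide_eq_right[symmetric] using N by blast
  have "-1/7 \<le> eig n R \<and> (4 \<le> card R \<longrightarrow> -1/7 + 1/1600 \<le> eig n R)"
  proof (cases "even (card R)")
    case True
    then show ?thesis
      using sum_phi_even[OF True R(2), of "even_graph n"] \<kappa> N unfolding eig by (simp add: field_simps)
  next
    case False
    then show ?thesis
      using sum_phi_odd[OF False, of "even_graph n"] \<kappa> N unfolding eig by (simp add: field_simps)
  qed
  then show "-1/7 \<le> eig n R" "4 \<le> card R \<Longrightarrow> -1/7 + 1/1600 \<le> eig n R" by auto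
qed

subsection \<open>Agreeing families\<close>

lemma no_odd_cycle_in_cut: "contains_odd_cycle G \<Longrightarrow> \<not> G \<subseteq> cut_edges n U"
proof
  assume "contains_odd_cycle G" and G: "G \<subseteq> cut_edges n U"
  then obtain vs where vs: "3 \<le> length vs" "odd (length vs)" "closed_walk_edges vs \<subseteq> G"
    by (auto simp: contains_odd_cycle_def odd_cycle_def)
  let ?L = "length vs"
  have alt: "(vs ! i \<in> U) \<noteq> (vs ! (Suc i mod ?L) \<in> U)" if "i < ?L" for i
  proof -
    have "{vs ! i, vs ! (Suc i mod ?L)} \<in> cut_edges n U"
      using that vs(3) G by (auto simp: closed_walk_edges_def)
    moreover from this have "vs ! i \<noteq> vs ! (Suc i mod ?L)" by (auto simp: cut_edges_def K_def)
    ultimately show ?thesis by (simp add: cut_edges_def odd_card_pair_Int)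
  qed
  have "(vs ! i \<in> U) = ((vs ! 0 \<in> U) = even i)" if "i < ?L" for i
    using that
  proof (induction i)
    case (Suc i)
    then show ?case using alt[of i] by auto
  qed simp
  moreover have L: "?L - 1 < ?L" "even (?L - 1)" "Suc (?L - 1) mod ?L = 0" using vs(1,2) by auto
  ultimately show False using alt[OF L(1)] unfolding L(3) by auto
qed

text \<open>Toggling \<open>e\<close> in \<open>R\<close> changes the sign of \<open>chi E R\<close>
  but neither \<open>R \<inter> B\<close> nor \<open>chi R D\<close>, so the terms cancel in
  pairs.\<close>

lemma sum_cut_orthogonal:
  assumes E: "finite E" "D \<subseteq> E" and e: "e \<in> E" "e \<notin> D" "e \<notin> B"
  shows "(\<Sum>R\<in>Pow E. chi E R * g (R \<inter> B) * chi R D) = 0"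
proof -
  let ?T = "\<lambda>R. chi E R * g (R \<inter> B) * chi D R"
  have fD: "finite D" using E finite_subset by blast
  have "?T (sym_diff R {e}) = - ?T R" for R
  proof -
    have "sym_diff R {e} \<inter> B = R \<inter> B" using e(3) by auto
    moreover have "chi E {e} = -1" using e(1) E by (simp add: chi_eq_power)
    moreover have "chi D {e} = 1" using e(2) by (simp add: chi_disjoint)
    ultimately show ?thesis by (simp add: chi_sym_diff)
  qed
  then have "(\<Sum>R\<in>Pow E. ?T R) = - (\<Sum>R\<in>Pow E. ?T R)"
    using sum_shift[of "{e}" E ?T] e(1) by (simp add: sum_negf)
  moreover have "(\<Sum>R\<in>Pow E. chi E R * g (R \<inter> B) * chi R D) = (\<Sum>R\<in>Pow E. ?T R)"
    using E fD by (intro sum.cong refl) (metis PowD chi_commute finite_subset)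
  ultimately show ?thesis by simp
qed

text \<open>All that the argument for the uniform measure takes from the odd cycles is that the
  agreement of two members is never bipartite.\<close>

lemma agreeing_not_in_cut:
  assumes "odd_cycle_agreeing n F" "G \<in> F" "H \<in> F"
  shows "\<not> K n - sym_diff G H \<subseteq> cut_edges n U"
  using assms no_odd_cycle_in_cut by (simp add: odd_cycle_agreeing_def)

lemma sum_eig_fourier:
  assumes F: "odd_cycle_agreeing n F"
  shows "(\<Sum>R\<in>Pow (K n). eig n R * (fourier (K n) (\<lambda>G. of_bool (G \<in> F)) R)\<^sup>2) = 0"
proof -
  let ?g = "\<lambda>G. of_bool (G \<in> F) :: real"
  have "(\<Sum>R\<in>Pow (K n). chi (K n) R * phi (even_graph n) (R \<inter> cut_edges n U) * (fourier (K n) ?g R)\<^sup>2) = 0" for U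
  proof -
    have "?g G * ?g H * (\<Sum>R\<in>Pow (K n). chi (K n) R * phi (even_graph n) (R \<inter> cut_edges n U) * chi R (sym_diff G H)) = 0"
      if "G \<in> Pow (K n)" "H \<in> Pow (K n)" for G H
    proof (cases "G \<in> F \<and> H \<in> F")
      case True
      then obtain e where "e \<in> K n" "e \<notin> sym_diff G H" "e \<notin> cut_edges n U" using agreeing_not_in_cut[OF F] by blast
      moreover have "sym_diff G H \<subseteq> K n" using that by auto
      ultimately show ?thesis using sum_cut_orthogonal[OF finite_K] by simp
    qed auto
    then show ?thesis by (simp only: sum_fourier_sq_mult[OF finite_K] sum.neutral_const cong: sum.cong)
  qed
  then have zero: "(\<Sum>U\<in>Pow {1..n}. \<Sum>R\<in>Pow (K n). chi (K n) R * phi (even_graph n) (R \<inter> cut_edges n U) * (fourier (K n) ?g R)\<^sup>2) = 0"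
    by simp
  have "(\<Sum>R\<in>Pow (K n). eig n R * (fourier (K n) ?g R)\<^sup>2)
    = (\<Sum>R\<in>Pow (K n). \<Sum>U\<in>Pow {1..n}. chi (K n) R * phi (even_graph n) (R \<inter> cut_edges n U) * (fourier (K n) ?g R)\<^sup>2) / 2 ^ n"
    by (simp add: eig_def sum_divide_distrib sum_distrib_left sum_distrib_right)
  also have "\<dots> = 0" by (subst sum.swap) (simp only: zero div_0)
  finally show ?thesis .
qed

text \<open>The squared coefficient at \<open>{}\<close> is \<mu> * \<mu>, and all squared
  coefficients add up to \<mu>. Writing the multiplier 1 at \<open>{}\<close> as 8/7 - 1/7 gives 8/7
  * \<mu> * \<mu> - 1/7 * \<mu> + W / 1600 \<le> 0.\<close>

lemma agreeing_hoffman: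
  assumes F: "odd_cycle_agreeing n F"
  defines "\<mu> \<equiv> density (K n) (\<lambda>G. G \<in> F)"
    and "W \<equiv> (\<Sum>R | R \<subseteq> K n \<and> 4 \<le> card R. (fourier (K n) (\<lambda>G. of_bool (G \<in> F)) R)\<^sup>2)"
  shows "W \<le> 1600 * (8/7 * \<mu> * (1/8 - \<mu>))"
proof -
  let ?f = "\<lambda>R. (fourier (K n) (\<lambda>G. of_bool (G \<in> F)) R)\<^sup>2"
  have f0: "?f {} = \<mu>\<^sup>2"
    by (simp add: fourier_def \<mu>_def density_def)
  have total: "(\<Sum>R\<in>Pow (K n). ?f R) = \<mu>"
    by (simp only: parseval[OF finite_K] \<mu>_def density_def) (simp add: power2_eq_square flip: of_bool_conj)
  have "(\<Sum>R\<in>Pow (K n). (if R = {} then 8/7 * ?f R else 0) - 1/7 * ?f R + 1/1600 * (if 4 \<le> card R then ?f R else 0))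
    \<le> (\<Sum>R\<in>Pow (K n). eig n R * ?f R)"
  proof (rule sum_mono)
    fix R assume R: "R \<in> Pow (K n)"
    show "(if R = {} then 8/7 * ?f R else 0) - 1/7 * ?f R + 1/1600 * (if 4 \<le> card R then ?f R else 0) \<le> eig n R * ?f R"
    proof (cases "R = {}")
      case True
      then show ?thesis by (simp add: eig_empty)
    next
      case False
      have "(-1/7 + (if 4 \<le> card R then 1/1600 else 0)) * ?f R \<le> eig n R * ?f R"
        using eig_lower[of R n] R False by (intro mult_right_mono) auto
      then show ?thesis using False by (simp add: algebra_simps split: if_splits)
    qed
  qed
  also have "\<dots> = 0" by (rule sum_eig_fourier[OF F])
  finally have "8/7 * ?f {} - 1/7 * (\<Sum>R\<in>Pow (K n). ?f R) + 1/1600 * (\<Sum>R\<in>Pow (K n). if 4 \<le> card R then ?f R else 0) \<le> 0"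
    unfolding sum.distrib sum_subtractf sum_distrib_left[symmetric] by (simp add: sum.delta)
  moreover have "(\<Sum>R\<in>Pow (K n). if 4 \<le> card R then ?f R else 0) = W"
    unfolding W_def by (simp add: sum.If_cases Int_def Pow_def conj_commute)
  ultimately show ?thesis unfolding f0 total by (simp add: power2_eq_square algebra_simps)
qed

subsection \<open>Stability for the uniform measure\<close>

lemma sum_slices:
  assumes "T \<subseteq> E"
  shows "(\<Sum>G\<in>Pow E. g G) = (\<Sum>X\<in>Pow T. \<Sum>Z\<in>Pow (E - T). g (X \<union> Z))"
proof -
  have "(\<Sum>G\<in>Pow E. g G) = (\<Sum>(X, Z)\<in>Pow T \<times> Pow (E - T). g (X \<union> Z))"
    by (rule sum.reindex_bij_witness[of _ "\<lambda>(X, Z). X \<union> Z" "\<lambda>G. (G \<inter> T, G - T)"])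
      (use assms in \<open>auto simp: Int_Diff_Un\<close>)
  then show ?thesis by (simp add: sum.cartesian_product)
qed

lemma density_slices:
  assumes "finite E" "T \<subseteq> E"
  shows "density E P = (\<Sum>X\<in>Pow T. density (E - T) (\<lambda>Z. P (X \<union> Z))) / 2 ^ card T"
proof -
  have "card E = card (E - T) + card T"
    using assms by (metis card_Diff_subset card_mono finite_subset le_add_diff_inverse2)
  then have "(2::real) ^ card E = 2 ^ card (E - T) * 2 ^ card T" by (simp add: power_add)
  then show ?thesis
    unfolding density_def sum_slices[OF assms(2)] by (simp add: sum_divide_distrib)
qed

lemma density_not: "finite E \<Longrightarrow> density E (\<lambda>x. \<not> P x) = 1 - density E P"
proof -
  assume E: "finite E"
  have "(\<Sum>x\<in>Pow E. of_bool (\<not> P x) :: real) = (\<Sum>x\<in>Pow E. 1 - of_bool (P x))"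
    by (intro sum.cong) auto
  also have "\<dots> = 2 ^ card E - (\<Sum>x\<in>Pow E. of_bool (P x))"
    using E by (simp add: sum_subtractf card_Pow del: sum_of_bool_eq)
  finally show ?thesis by (simp add: density_def diff_divide_distrib del: sum_of_bool_eq)
qed

definition junta :: "nat \<Rightarrow> graph \<Rightarrow> graph \<Rightarrow> graph set" where
  "junta n T X = {G. G \<subseteq> K n \<and> G \<inter> T = X}"

lemma power3_triangle: "triangle n T \<Longrightarrow> (2::real) ^ card T = 8"
  by (simp add: card_triangle)

text \<open>Let m X be the density on the slice \<open>G \<inter> T = X\<close>. Shifts outside
  \<open>T\<close> act within each slice, so near invariance bounds the sum of m X * (1 - m X):
  every slice is nearly empty or nearly full. As the m X add up to at most 1, the slices other than
  the heaviest one hold at most what that one lacks. The measure of \<open>F\<close> is kept as a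
  factor to avoid a division.\<close>

lemma nearly_invariant_near_junta:
  assumes T: "triangle n T"
    and inv: "\<And>y. y \<subseteq> K n - T \<Longrightarrow> density (K n) (deriv y (\<lambda>G. G \<in> F)) \<le> \<eta>"
    and \<mu>: "density (K n) (\<lambda>G. G \<in> F) \<le> 1/8"
  shows "\<exists>X\<subseteq>T. density (K n) (\<lambda>G. G \<in> sym_diff (junta n T X) F) * density (K n) (\<lambda>G. G \<in> F) \<le> \<eta> / 8"
proof -
  let ?E = "K n" and ?E' = "K n - T" and ?f = "\<lambda>G. G \<in> F"
  let ?\<mu> = "density ?E ?f"
  have TE: "T \<subseteq> ?E" by (rule triangle_subset_K[OF T])
  have finT: "finite T" using TE finite_K finite_subset by blast
  note slices = density_slices[OF finite_K TE, unfolded power3_triangle[OF T]]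
  define m where "m X = density ?E' (\<lambda>Z. X \<union> Z \<in> F)" for X
  have m: "0 \<le> m X" "m X \<le> 1" for X
    by (simp_all add: m_def density_nonneg density_le_1)
  have sum_m: "(\<Sum>X\<in>Pow T. m X) = 8 * ?\<mu>"
    using slices[of ?f] by (simp add: m_def)
  have "(\<Sum>y\<in>Pow ?E'. density ?E (deriv y ?f)) \<le> (\<Sum>y\<in>Pow ?E'. \<eta>)"
    using inv by (intro sum_mono) auto
  then have "(\<Sum>y\<in>Pow ?E'. density ?E (deriv y ?f)) \<le> 2 ^ card ?E' * \<eta>"
    by (simp add: card_Pow)
  moreover have "(\<Sum>y\<in>Pow ?E'. density ?E (deriv y ?f))
    = (\<Sum>y\<in>Pow ?E'. \<Sum>X\<in>Pow T. density ?E' (deriv y (\<lambda>Z. X \<union> Z \<in> F))) / 8"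
  proof -
    have "density ?E (deriv y ?f) = (\<Sum>X\<in>Pow T. density ?E' (deriv y (\<lambda>Z. X \<union> Z \<in> F))) / 8"
      if y: "y \<in> Pow ?E'" for y
    proof -
      have "sym_diff (X \<union> Z) y = X \<union> sym_diff Z y" if "X \<in> Pow T" for X Z using that y by blast
      then show ?thesis unfolding slices[of "deriv y ?f"] deriv_def
        by (intro arg_cong[where f = "\<lambda>x. x / 8"] sum.cong refl) simp
    qed
    then show ?thesis unfolding sum_divide_distrib by (intro sum.cong refl) (simp add: sum_divide_distrib)
  qed
  moreover have "(\<Sum>y\<in>Pow ?E'. \<Sum>X\<in>Pow T. density ?E' (deriv y (\<lambda>Z. X \<union> Z \<in> F)))
    = (\<Sum>X\<in>Pow T. 2 ^ card ?E' * (2 * m X * (1 - m X)))"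
    by (subst sum.swap, intro sum.cong refl) (simp add: sum_density_deriv m_def)
  ultimately have "2 ^ card ?E' * (\<Sum>X\<in>Pow T. 2 * m X * (1 - m X)) / 8 \<le> 2 ^ card ?E' * \<eta>"
    by (simp add: sum_distrib_left)
  then have *: "(\<Sum>X\<in>Pow T. m X * (1 - m X)) \<le> 4 * \<eta>"
    by (simp add: sum_distrib_left[symmetric] mult.assoc)
  obtain X0 where X0: "X0 \<in> Pow T" "\<And>X. X \<in> Pow T \<Longrightarrow> m X \<le> m X0"
  proof -
    have fin: "finite (m ` Pow T)" using finT by simp
    then have "Max (m ` Pow T) \<in> m ` Pow T" by (intro Max_in) auto
    then obtain X0 where "X0 \<in> Pow T" "Max (m ` Pow T) = m X0" by blast
    then show thesis using that[of X0] Max_ge[OF fin] by auto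
  qed
  have "(1 - m X0) * (8 * ?\<mu>) = (\<Sum>X\<in>Pow T. m X * (1 - m X0))"
    unfolding sum_m[symmetric] sum_distrib_left by (simp add: mult.commute)
  also have "\<dots> \<le> (\<Sum>X\<in>Pow T. m X * (1 - m X))"
    using X0(2) m by (intro sum_mono mult_left_mono) auto
  finally have max: "(1 - m X0) * (8 * ?\<mu>) \<le> 4 * \<eta>" using * by linarith
  have "density ?E (\<lambda>G. G \<in> sym_diff (junta n T X0) F) = (\<Sum>X\<in>Pow T. if X = X0 then 1 - m X else m X) / 8"
  proof (subst slices, intro arg_cong[where f = "\<lambda>x. x / 8"] sum.cong refl)
    fix X assume X: "X \<in> Pow T"
    have "X \<union> Z \<in> sym_diff (junta n T X0) F \<longleftrightarrow> (if X = X0 then X \<union> Z \<notin> F else X \<union> Z \<in> F)" if "Z \<subseteq> ?E'" for Z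
    proof -
      have "X \<union> Z \<subseteq> K n" "(X \<union> Z) \<inter> T = X" using X that TE by auto
      then show ?thesis by (auto simp: junta_def)
    qed
    then have "density ?E' (\<lambda>Z. X \<union> Z \<in> sym_diff (junta n T X0) F)
      = density ?E' (\<lambda>Z. if X = X0 then X \<union> Z \<notin> F else X \<union> Z \<in> F)"
      unfolding density_def by (intro arg_cong[where f = "\<lambda>x. x / _"] sum.cong) auto
    then show "density ?E' (\<lambda>Z. X \<union> Z \<in> sym_diff (junta n T X0) F) = (if X = X0 then 1 - m X else m X)"
      by (simp add: density_not m_def)
  qed
  also have "(\<Sum>X\<in>Pow T. if X = X0 then 1 - m X else m X) = (\<Sum>X\<in>Pow T. m X + (if X = X0 then 1 - 2 * m X0 else 0))"
    by (intro sum.cong) auto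
  also have "\<dots> = 8 * ?\<mu> + (1 - 2 * m X0)"
    using X0(1) finT by (simp add: sum.distrib sum_m)
  also have "\<dots> \<le> 2 * (1 - m X0)" using \<mu> by simp
  finally have "density ?E (\<lambda>G. G \<in> sym_diff (junta n T X0) F) \<le> (1 - m X0) / 4" by simp
  then have "density ?E (\<lambda>G. G \<in> sym_diff (junta n T X0) F) * ?\<mu> \<le> (1 - m X0) / 4 * ?\<mu>"
    by (rule mult_right_mono) (rule density_nonneg)
  also have "\<dots> \<le> \<eta> / 8" using max by (simp add: field_simps)
  finally show ?thesis using X0(1) by blast
qed

lemma agreeing_density_le:
  assumes "odd_cycle_agreeing n F"
  shows "density (K n) (\<lambda>G. G \<in> F) \<le> 1/8"
proof (rule ccontr)
  let ?\<mu> = "density (K n) (\<lambda>G. G \<in> F)"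
  assume "\<not> ?thesis"
  then have "?\<mu> * (1/8 - ?\<mu>) < 0" by (intro mult_pos_neg) auto
  moreover have "0 \<le> (\<Sum>R | R \<subseteq> K n \<and> 4 \<le> card R. (fourier (K n) (\<lambda>G. of_bool (G \<in> F)) R)\<^sup>2)"
    by (intro sum_nonneg) auto
  ultimately show False using agreeing_hoffman[OF assms] by simp
qed

lemma ex_triangle: "3 \<le> n \<Longrightarrow> \<exists>T. triangle n T"
  unfolding triangle_def by (intro exI[of _ "{{1, 2}, {2, 3}, {1, 3}}"] exI[of _ 1] exI[of _ 2] exI[of _ 3]) auto

text \<open>The stabiliser of an almost extremal family is a subgroup of index eight: by
  \<open>density_gap\<close> every shift either almost preserves the family or almost moves it off itself.\<close>

lemma agreeing_stability:
  assumes n: "3 \<le> n" and F: "odd_cycle_agreeing n F"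
    and \<mu>: "1/8 - \<epsilon> \<le> density (K n) (\<lambda>G. G \<in> F)"
  shows "\<exists>T X. triangle n T \<and> X \<subseteq> T \<and> density (K n) (\<lambda>G. G \<in> sym_diff (junta n T X) F) \<le> 10 ^ 8 * \<epsilon>"
proof (cases "1 \<le> 10 ^ 8 * \<epsilon>")
  case True
  obtain T where "triangle n T" using ex_triangle[OF n] by blast
  moreover have "density (K n) (\<lambda>G. G \<in> sym_diff (junta n T {}) F) \<le> 1"
    by (rule density_le_1[OF finite_K])
  ultimately show ?thesis using True by (intro exI[of _ T] exI[of _ "{}"]) auto
next
  case False
  let ?E = "K n" and ?f = "\<lambda>G. G \<in> F"
  let ?\<mu> = "density ?E ?f"
  let ?W = "\<Sum>R | R \<subseteq> ?E \<and> 4 \<le> card R. (fourier ?E (\<lambda>G. of_bool (G \<in> F)) R)\<^sup>2"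
  have \<mu>8: "?\<mu> \<le> 1/8" by (rule agreeing_density_le[OF F])
  have \<epsilon>: "0 \<le> \<epsilon>" using \<mu> \<mu>8 by linarith
  define \<eta> where "\<eta> = 1404343 * \<epsilon>" \<comment> \<open>\<open>24 \<cdot> 256 \<cdot> 1600 / 7\<close>, rounded up\<close>
  have \<eta>0: "0 \<le> \<eta>" using \<epsilon> by (simp add: \<eta>_def)
  \<comment> \<open>The factor 10^8 is chosen to make \<eta> this small; the last estimate yields
    only 2 * \<eta>.\<close>
  have small: "\<epsilon> < 1 / 10 ^ 8" "\<eta> < 1/60" using False by (simp_all add: \<eta>_def)
  have "?\<mu> * (1/8 - ?\<mu>) \<le> 1/8 * \<epsilon>"
    using \<mu> \<mu>8 by (intro mult_mono) auto
  then have "24 * (256 * ?W) \<le> \<eta>"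
    using agreeing_hoffman[OF F] \<epsilon> by (simp add: \<eta>_def)
  have d4: "density ?E (deriv a (deriv b (deriv c (deriv d ?f)))) \<le> \<eta>"
    if "a \<subseteq> ?E" "b \<subseteq> ?E" "c \<subseteq> ?E" "d \<subseteq> ?E" for a b c d
  proof -
    have "density ?E (deriv a (deriv b (deriv c (deriv d ?f)))) \<le> 24 * (256 * ?W)"
      by (rule density_deriv4[OF density_deriv4_disjoint[OF finite_K] that])
    then show ?thesis using \<open>24 * (256 * ?W) \<le> \<eta>\<close> by linarith
  qed
  \<comment> \<open>One derivative is spent on \<open>y\<close>, which leaves three of the four for
    \<open>density_gap\<close>; hence the denominator 4.\<close>
  have gap: "density ?E (deriv y ?f) \<le> \<eta> \<or> (1 - \<eta>) / 4 \<le> density ?E (deriv y ?f)" if y: "y \<subseteq> ?E" for y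
  proof -
    have "density ?E (foldr deriv ys (deriv y ?f)) \<le> \<eta>" if ys: "length ys = Suc 2" "set ys \<subseteq> Pow ?E" for ys
    proof -
      obtain a b c where "ys = [a, b, c]" using ys(1) by (auto simp: length_Suc_conv numeral_2_eq_2)
      then show ?thesis using d4[of a b c y] ys(2) y by simp
    qed
    then show ?thesis using density_gap[OF finite_K \<eta>0, of 2 n "deriv y ?f"] by simp
  qed
  define S where "S = {y. y \<subseteq> ?E \<and> density ?E (deriv y ?f) \<le> \<eta>}"
  have S: "cube_subgroup ?E S"
    unfolding cube_subgroup_def
  proof (intro conjI ballI)
    show "S \<subseteq> Pow ?E" by (auto simp: S_def)
    have "density ?E (deriv {} ?f) = 0" by (simp add: density_def deriv_def)
    then show "{} \<in> S" using \<eta>0 by (simp add: S_def)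
    fix x y assume xy: "x \<in> S" "y \<in> S"
    then have sub: "x \<subseteq> ?E" "y \<subseteq> ?E" "sym_diff x y \<subseteq> ?E" by (auto simp: S_def)
    have "density ?E (deriv (sym_diff x y) ?f) \<le> 2 * \<eta>"
      using density_deriv_sym_diff_le[OF sub(1,2), of ?f] xy by (simp add: S_def)
    also have "\<dots> < (1 - \<eta>) / 4" using small(2) by simp
    finally have "density ?E (deriv (sym_diff x y) ?f) \<le> \<eta>" using gap[OF sub(3)] by (simp only: not_le[symmetric] simp_thms)
    then show "sym_diff x y \<in> S" using sub(3) by (simp add: S_def)
  qed
  define N where "N = (2::real) ^ card ?E"
  have N: "N > 0" by (simp add: N_def)
  have Ssub: "S \<subseteq> Pow ?E" by (auto simp: S_def)
  have finS: "finite S" by (rule finite_subset[OF Ssub]) simp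
  have cc: "real (card (Pow ?E - S)) = N - card S"
    using card_Diff_subset[OF finS Ssub] card_mono[OF _ Ssub] by (simp add: card_Pow N_def)
  \<comment> \<open>The average over all shifts is known exactly. Each shift outside
    \<open>S\<close> contributes between (1 - \<eta>) / 4 and 2 * \<mu>, which bounds their number
    from both sides.\<close>
  have "N * (2 * ?\<mu> * (1 - ?\<mu>)) = (\<Sum>y\<in>S. density ?E (deriv y ?f)) + (\<Sum>y\<in>Pow ?E - S. density ?E (deriv y ?f))"
    using sum.subset_diff[OF Ssub, of "\<lambda>y. density ?E (deriv y ?f)"] sum_density_deriv[OF finite_K, of n ?f]
    by (simp add: N_def)
  moreover have "0 \<le> (\<Sum>y\<in>S. density ?E (deriv y ?f))" by (intro sum_nonneg density_nonneg)
  moreover have "(\<Sum>y\<in>S. density ?E (deriv y ?f)) \<le> card S * \<eta>"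
    using sum_bounded_above[of S "\<lambda>y. density ?E (deriv y ?f)" \<eta>] by (simp add: S_def)
  moreover have "card (Pow ?E - S) * ((1 - \<eta>) / 4) \<le> (\<Sum>y\<in>Pow ?E - S. density ?E (deriv y ?f))"
    using gap by (intro sum_bounded_below) (auto simp: S_def)
  moreover have "(\<Sum>y\<in>Pow ?E - S. density ?E (deriv y ?f)) \<le> card (Pow ?E - S) * (2 * ?\<mu>)"
    by (intro sum_bounded_above density_deriv_le) auto
  ultimately have low: "(N - card S) * ((1 - \<eta>) / 4) \<le> N * (2 * ?\<mu> * (1 - ?\<mu>))"
    and up: "N * (2 * ?\<mu> * (1 - ?\<mu>)) \<le> card S * \<eta> + (N - card S) * (2 * ?\<mu>)"
    unfolding cc by linarith+
  obtain I where I: "I \<subseteq> ?E" "independent_mod S I" "spanning_mod ?E S I"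
    using ex_independent_spanning[OF finite_K S] .
  have cI: "2 ^ card I * card S = 2 ^ card ?E"
    using spanning_mod_iff_card[OF finite_K S I(1,2)] I(3) by blast
  define s where "s = card S / N"
  have s: "s = 1 / 2 ^ card I"
  proof -
    have "real (2 ^ card I * card S) = N" unfolding cI by (simp add: N_def)
    then show ?thesis using N by (simp add: s_def field_simps)
  qed
  have \<mu>16: "1/16 \<le> ?\<mu>" "1/8 - 1/10^8 \<le> ?\<mu>" using \<mu> small(1) by simp_all
  \<comment> \<open>For \<mu> = 1/8 and \<eta> = 0 the two bounds would give exactly s = 1/8. As
    \<open>s\<close> is a power of 1/2, it is enough to keep it strictly between 1/16 and
    1/4.\<close>
  have "1/16 < s"
  proof -
    have "(1 - s) * ((1 - \<eta>) / 4) \<le> 2 * ?\<mu> * (1 - ?\<mu>)"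
      using low N by (simp add: s_def field_simps)
    also have "\<dots> \<le> 7/32"
    proof -
      have "0 \<le> (1/8 - ?\<mu>) * (7/8 - ?\<mu>)" using \<mu>8 by (intro mult_nonneg_nonneg) auto
      then show ?thesis by (simp add: algebra_simps)
    qed
    finally have "(1 - s) * (1 - \<eta>) \<le> 7/8" by (simp add: mult.commute)
    show ?thesis
    proof (rule ccontr)
      assume "\<not> 1/16 < s"
      then have "15/16 * (59/60) \<le> (1 - s) * (1 - \<eta>)" using small(2) by (intro mult_mono) auto
      then show False using \<open>(1 - s) * (1 - \<eta>) \<le> 7/8\<close> by simp
    qed
  qed
  moreover have "s < 1/4"
  proof (rule ccontr)
    assume "\<not> s < 1/4"
    have "2 * ?\<mu> * (1 - ?\<mu>) \<le> s * \<eta> + (1 - s) * (2 * ?\<mu>)"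
      using up N by (simp add: s_def field_simps)
    then have "s * (2 * ?\<mu> - \<eta>) \<le> 2 * ?\<mu> * ?\<mu>" by (simp add: algebra_simps)
    also have "\<dots> \<le> 1/4 * ?\<mu>" using \<mu>8 density_nonneg[of ?E ?f] by (intro mult_right_mono) auto
    finally have "s * (2 * ?\<mu> - \<eta>) \<le> 1/4 * ?\<mu>" .
    moreover have "1/4 * (2 * ?\<mu> - \<eta>) \<le> s * (2 * ?\<mu> - \<eta>)"
      using \<open>\<not> s < 1/4\<close> \<mu>16(1) small(2) by (intro mult_right_mono) auto
    ultimately have "1/4 * (2 * ?\<mu> - \<eta>) \<le> 1/4 * ?\<mu>" by (rule order_trans[rotated])
    then show False using \<mu>16(1) small(2) by simp
  qed
  ultimately have "(2::real) ^ 2 < 2 ^ card I" "(2::real) ^ card I < 2 ^ 4"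
    unfolding s by (simp_all add: field_simps)
  then have "card I = 3"
    using power_less_imp_less_exp[of "2::real" 2 "card I"] power_less_imp_less_exp[of "2::real" "card I" 4] by simp
  then have card8: "8 * card S = 2 ^ card ?E" using cI by simp
  have bip: "?E - B \<notin> S" if B: "B \<subseteq> cut_edges n U" for U B
  proof
    assume "?E - B \<in> S"
    then have "density ?E (deriv (?E - B) ?f) \<le> \<eta>" by (simp add: S_def)
    \<comment> \<open>A graph and its shift by the complement of \<open>B\<close> agree only on
      edges of \<open>B\<close>, so no member is moved to a member.\<close>
    moreover have "density ?E (deriv (?E - B) ?f) = 2 * ?\<mu>"
    proof (rule density_deriv_disjoint)
      fix x assume x: "x \<subseteq> ?E" "x \<in> F"
      have "?E - sym_diff x (sym_diff x (?E - B)) = ?E - (?E - B)" by blast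
      also have "\<dots> \<subseteq> cut_edges n U" using B by blast
      finally show "sym_diff x (?E - B) \<notin> F" using agreeing_not_in_cut[OF F x(2)] by blast
    qed blast
    ultimately show False using \<mu>16 small(2) by linarith
  qed
  obtain T where T: "triangle n T" "S = Pow (?E - T)"
    using subgroup_index_8_triangle[OF S card8 bip] .
  obtain X where X: "X \<subseteq> T" "density ?E (\<lambda>G. G \<in> sym_diff (junta n T X) F) * ?\<mu> \<le> \<eta> / 8"
    using nearly_invariant_near_junta[OF T(1) _ \<mu>8, of \<eta>] T(2) by (auto simp: S_def)
  have "density ?E (\<lambda>G. G \<in> sym_diff (junta n T X) F) * (1/16) \<le> density ?E (\<lambda>G. G \<in> sym_diff (junta n T X) F) * ?\<mu>"
    using \<mu>16 by (intro mult_left_mono density_nonneg) auto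
  then have "density ?E (\<lambda>G. G \<in> sym_diff (junta n T X) F) \<le> 10 ^ 8 * \<epsilon>"
    using X(2) \<epsilon> by (simp add: \<eta>_def)
  then show ?thesis using T(1) X(1) by blast
qed

subsection \<open>Biased measures of increasing families\<close>

text \<open>The ground set is arbitrary so that the comparison of different \<open>p\<close> can
  remove one element at a time.\<close>

definition bias :: "'a set \<Rightarrow> real \<Rightarrow> ('a set \<Rightarrow> bool) \<Rightarrow> real" where
  "bias E p P = (\<Sum>G\<in>Pow E. of_bool (P G) * (p ^ card G * (1 - p) ^ (card E - card G)))"

lemma bias_cong: "(\<And>G. G \<subseteq> E \<Longrightarrow> P G = Q G) \<Longrightarrow> bias E p P = bias E p Q"
  unfolding bias_def by (intro sum.cong) auto

lemma bias_nonneg: "0 \<le> p \<Longrightarrow> p \<le> 1 \<Longrightarrow> 0 \<le> bias E p P"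
  unfolding bias_def by (intro sum_nonneg mult_nonneg_nonneg) auto

lemma bias_mono:
  assumes "0 \<le> p" "p \<le> 1" "\<And>G. G \<subseteq> E \<Longrightarrow> P G \<Longrightarrow> Q G"
  shows "bias E p P \<le> bias E p Q"
  unfolding bias_def using assms by (intro sum_mono mult_right_mono mult_nonneg_nonneg) auto

lemma bias_insert:
  assumes "finite E" "e \<notin> E"
  shows "bias (insert e E) p P = p * bias E p (\<lambda>G. P (insert e G)) + (1 - p) * bias E p P"
proof -
  let ?w = "\<lambda>G. of_bool (P G) * (p ^ card G * (1 - p) ^ (card (insert e E) - card G))"
  have inj: "inj_on (insert e) (Pow E)" using assms(2) by (auto simp: inj_on_def)
  have "bias (insert e E) p P = (\<Sum>G\<in>Pow E. ?w G) + (\<Sum>G\<in>insert e ` Pow E. ?w G)"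
    unfolding bias_def Pow_insert by (rule sum.union_disjoint) (use assms in auto)
  also have "(\<Sum>G\<in>insert e ` Pow E. ?w G) = (\<Sum>G\<in>Pow E. ?w (insert e G))"
    by (simp add: sum.reindex[OF inj])
  also have "\<dots> = p * bias E p (\<lambda>G. P (insert e G))"
    unfolding bias_def sum_distrib_left
  proof (rule sum.cong[OF refl])
    fix G assume "G \<in> Pow E"
    then have "finite G" "e \<notin> G" using assms finite_subset by auto
    then show "?w (insert e G) = p * (of_bool (P (insert e G)) * (p ^ card G * (1 - p) ^ (card E - card G)))"
      using assms by simp
  qed
  also have "(\<Sum>G\<in>Pow E. ?w G) = (1 - p) * bias E p P"
    unfolding bias_def sum_distrib_left
  proof (rule sum.cong[OF refl])
    fix G assume "G \<in> Pow E"
    then have "card G \<le> card E" using assms by (simp add: card_mono)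
    then show "?w G = (1 - p) * (of_bool (P G) * (p ^ card G * (1 - p) ^ (card E - card G)))"
      using assms by (simp add: Suc_diff_le)
  qed
  finally show ?thesis by simp
qed

lemma bias_superset:
  assumes "finite E" "T \<subseteq> E"
  shows "bias E p (\<lambda>G. T \<subseteq> G) = p ^ card T"
  using assms
proof (induction E arbitrary: T)
  case empty
  then show ?case by (simp add: bias_def)
next
  case (insert e E)
  show ?case
  proof (cases "e \<in> T")
    case True
    then have "bias E p (\<lambda>G. T \<subseteq> insert e G) = bias E p (\<lambda>G. T - {e} \<subseteq> G)"
      by (intro bias_cong) auto
    also have "\<dots> = p ^ card (T - {e})" using insert by (intro insert.IH) auto
    finally have 1: "bias E p (\<lambda>G. T \<subseteq> insert e G) = p ^ card (T - {e})" .
    have "bias E p (\<lambda>G. T \<subseteq> G) = bias E p (\<lambda>G. False)"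
      using True insert.hyps(2) by (intro bias_cong) auto
    then have 2: "bias E p (\<lambda>G. T \<subseteq> G) = 0" by (simp add: bias_def)
    have "finite T" using insert finite_subset by blast
    then have "card T = Suc (card (T - {e}))" using True by (simp only: card_Suc_Diff1)
    then show ?thesis using insert.hyps 1 2 by (simp add: bias_insert)
  next
    case False
    then have "bias E p (\<lambda>G. T \<subseteq> insert e G) = bias E p (\<lambda>G. T \<subseteq> G)"
      by (intro bias_cong) auto
    moreover have "bias E p (\<lambda>G. T \<subseteq> G) = p ^ card T" using False insert by (intro insert.IH) auto
    ultimately show ?thesis using insert.hyps by (simp add: bias_insert algebra_simps)
  qed
qed

lemma bias_le_1:
  assumes "finite E" "0 \<le> p" "p \<le> 1"
  shows "bias E p P \<le> 1"
  using bias_mono[OF assms(2,3), of E P "\<lambda>G. {} \<subseteq> G"] bias_superset[OF assms(1), of "{}" p] by simp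

lemma bias_half: "finite E \<Longrightarrow> bias E (1/2) P = density E P"
proof -
  assume E: "finite E"
  have "(1/2) ^ card G * (1 - 1/2) ^ (card E - card G) = 1 / (2::real) ^ card E" if "G \<in> Pow E" for G
  proof -
    have "card G \<le> card E" using that E by (simp add: card_mono)
    then have "(1/2::real) ^ card G * (1/2) ^ (card E - card G) = (1/2) ^ card E" by (simp flip: power_add)
    then show ?thesis by (simp add: power_one_over)
  qed
  then have "bias E (1/2) P = (\<Sum>G\<in>Pow E. of_bool (P G) * (1 / 2 ^ card E))"
    unfolding bias_def by (intro sum.cong refl) simp
  then show ?thesis unfolding density_def sum_divide_distrib by simp
qed

definition increasing_on :: "'a set \<Rightarrow> ('a set \<Rightarrow> bool) \<Rightarrow> bool" where
  "increasing_on E P \<longleftrightarrow> (\<forall>G H. G \<subseteq> H \<and> H \<subseteq> E \<and> P G \<longrightarrow> P H)"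

text \<open>With s = p * (y - x), the intervals from p * x to p * y and from x to x + s have the
  same length, and by concavity t powr \<alpha> grows less over the second. The choice of \<alpha>
  turns (p * y) powr \<alpha> into half of y powr \<alpha>.\<close>

lemma powr_two_point:
  fixes p \<alpha> x y :: real
  assumes p: "0 < p" "p \<le> 1" and \<alpha>: "0 < \<alpha>" "\<alpha> \<le> 1" "p powr \<alpha> = 1/2" and xy: "0 \<le> x" "x \<le> y"
  shows "(p * y + (1 - p) * x) powr \<alpha> \<le> (x powr \<alpha> + y powr \<alpha>) / 2"
proof (cases "x = 0")
  case True
  then show ?thesis using p xy by (simp add: powr_mult \<alpha>(3))
next
  case False
  then have x: "0 < x" using xy by simp
  define s where "s = p * (y - x)"
  have s: "0 \<le> s" using p xy by (simp add: s_def)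
  have "(x + s) powr \<alpha> - x powr \<alpha> \<le> (p * x + s) powr \<alpha> - (p * x) powr \<alpha>"
  proof (rule DERIV_nonpos_imp_nonincreasing[of "p * x" x "\<lambda>t. (t + s) powr \<alpha> - t powr \<alpha>"])
    show "p * x \<le> x" using p x by simp
    fix t assume "p * x \<le> t" "t \<le> x"
    then have t: "0 < t" using p x by (meson mult_pos_pos less_le_trans)
    have "((\<lambda>t. (t + s) powr \<alpha> - t powr \<alpha>) has_real_derivative
        \<alpha> * (t + s) powr (\<alpha> - 1) - \<alpha> * t powr (\<alpha> - 1)) (at t)"
      using t s by (auto intro!: derivative_eq_intros simp: powr_diff divide_simps)
    moreover have "(t + s) powr (\<alpha> - 1) \<le> t powr (\<alpha> - 1)"
      using t s \<alpha> by (intro powr_mono2') auto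
    then have "\<alpha> * (t + s) powr (\<alpha> - 1) - \<alpha> * t powr (\<alpha> - 1) \<le> 0" using \<alpha> by simp
    ultimately show "\<exists>d. ((\<lambda>t. (t + s) powr \<alpha> - t powr \<alpha>) has_real_derivative d) (at t) \<and> d \<le> 0" by blast
  qed
  moreover have "p * x + s = p * y" "x + s = p * y + (1 - p) * x" by (simp_all add: s_def algebra_simps)
  ultimately have "(p * y + (1 - p) * x) powr \<alpha> \<le> x powr \<alpha> + (p * y) powr \<alpha> - (p * x) powr \<alpha>" by simp
  then show ?thesis using p xy by (simp add: powr_mult \<alpha>(3))
qed

text \<open>For increasing families the logarithm of the measure to base \<open>p\<close> does not increase with \<open>p\<close>;
  this compares \<open>p\<close> with \<open>1/2 = p powr \<alpha>\<close>.\<close>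

lemma bias_powr_le:
  assumes E: "finite E" and inc: "increasing_on E P"
    and p: "0 < p" "p \<le> 1" and \<alpha>: "0 < \<alpha>" "\<alpha> \<le> 1" "p powr \<alpha> = 1/2"
  shows "bias E p P powr \<alpha> \<le> bias E (1/2) P"
  using E inc
proof (induction E arbitrary: P)
  case empty
  then show ?case by (cases "P {}") (simp_all add: bias_def)
next
  case (insert e E)
  let ?Q = "\<lambda>G. P (insert e G)"
  have inc: "increasing_on E P" "increasing_on E ?Q"
    using insert.prems unfolding increasing_on_def by (blast, meson insert_mono)
  have "bias E p P \<le> bias E p ?Q"
    using insert.prems p unfolding increasing_on_def by (intro bias_mono) (auto, meson insert_mono subset_insertI)
  then have "(p * bias E p ?Q + (1 - p) * bias E p P) powr \<alpha> \<le> (bias E p P powr \<alpha> + bias E p ?Q powr \<alpha>) / 2"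
    using bias_nonneg[of p E P] p by (intro powr_two_point[OF p \<alpha>]) auto
  also have "\<dots> \<le> (bias E (1/2) P + bias E (1/2) ?Q) / 2"
    using insert.IH[OF inc(1)] insert.IH[OF inc(2)] by simp
  finally show ?case using insert.hyps by (simp add: bias_insert)
qed

lemma ex_half_exponent:
  fixes p :: real
  assumes "0 < p" "p \<le> 1/2"
  obtains \<alpha> where "0 < \<alpha>" "\<alpha> \<le> 1" "p powr \<alpha> = 1/2"
proof
  define \<alpha> where "\<alpha> = ln (1/2) / ln p"
  have l: "ln p \<le> ln (1/2)" "ln (1/2 :: real) < 0"
    by (subst ln_le_cancel_iff, use assms in \<open>simp_all add: ln_div\<close>)
  then have lp: "ln p < 0" by linarith
  show "0 < \<alpha>" unfolding \<alpha>_def by (rule divide_neg_neg[OF l(2) lp])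
  show "\<alpha> \<le> 1" unfolding \<alpha>_def neg_divide_le_eq[OF lp] using l(1) by simp
  show "p powr \<alpha> = 1/2" using lp assms unfolding powr_def \<alpha>_def by simp
qed

text \<open>On the unit interval t \<le> t powr \<alpha>, so the preceding comparison contains this
  monotonicity.\<close>

lemma bias_le_half:
  assumes E: "finite E" "increasing_on E P" and p: "0 < p" "p \<le> 1/2"
  shows "bias E p P \<le> bias E (1/2) P"
proof -
  obtain \<alpha> where \<alpha>: "0 < \<alpha>" "\<alpha> \<le> 1" "p powr \<alpha> = 1/2" using ex_half_exponent[OF p] .
  have x: "0 \<le> bias E p P" "bias E p P \<le> 1" using bias_nonneg[of p E P] bias_le_1[OF E(1), of p P] p by auto
  have "bias E p P = bias E p P powr 1" using x by simp
  also have "\<dots> \<le> bias E p P powr \<alpha>" using x \<alpha> by (intro powr_mono') auto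
  also have "\<dots> \<le> bias E (1/2) P" using p by (intro bias_powr_le[OF E _ _ \<alpha>]) auto
  finally show ?thesis .
qed

subsection \<open>Intersecting families for the biased measures\<close>

definition up_closure :: "nat \<Rightarrow> graph set \<Rightarrow> graph set" where
  "up_closure n F = {G. G \<subseteq> K n \<and> (\<exists>H\<in>F. H \<subseteq> G)}"

lemma mu_eq_bias:
  assumes "F \<subseteq> Pow (K n)"
  shows "mu n p F = bias (K n) p (\<lambda>G. G \<in> F)"
proof -
  have "bias (K n) p (\<lambda>G. G \<in> F) = (\<Sum>G\<in>Pow (K n). if G \<in> F then mu_graph n p G else 0)"
    unfolding bias_def mu_graph_def by (intro sum.cong) auto
  also have "\<dots> = (\<Sum>G\<in>Pow (K n) \<inter> F. mu_graph n p G)" by (simp add: sum.inter_restrict)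
  also have "Pow (K n) \<inter> F = F" using assms by blast
  finally show ?thesis by (simp add: mu_def)
qed

lemma mu_half: "F \<subseteq> Pow (K n) \<Longrightarrow> mu n (1/2) F = density (K n) (\<lambda>G. G \<in> F)"
  by (simp add: mu_eq_bias bias_half)

lemma contains_odd_cycle_mono: "contains_odd_cycle G \<Longrightarrow> G \<subseteq> H \<Longrightarrow> contains_odd_cycle H"
  unfolding contains_odd_cycle_def by blast

lemma intersecting_imp_agreeing:
  assumes "odd_cycle_intersecting n F" shows "odd_cycle_agreeing n F"
  unfolding odd_cycle_agreeing_def
proof (intro conjI ballI)
  show sub: "F \<subseteq> Pow (K n)" using assms by (simp add: odd_cycle_intersecting_def)
  fix G H assume GH: "G \<in> F" "H \<in> F"
  then have "contains_odd_cycle (G \<inter> H)" using assms by (simp add: odd_cycle_intersecting_def)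
  moreover have "G \<inter> H \<subseteq> K n - sym_diff G H" using GH sub by blast
  ultimately show "contains_odd_cycle (K n - sym_diff G H)" by (rule contains_odd_cycle_mono)
qed

lemma up_closure:
  assumes "odd_cycle_intersecting n F"
  shows "F \<subseteq> up_closure n F" "odd_cycle_intersecting n (up_closure n F)"
    "increasing_on (K n) (\<lambda>G. G \<in> up_closure n F)"
proof -
  show "F \<subseteq> up_closure n F" using assms by (auto simp: up_closure_def odd_cycle_intersecting_def)
  show "increasing_on (K n) (\<lambda>G. G \<in> up_closure n F)"
    unfolding increasing_on_def
  proof (intro allI impI, elim conjE)
    fix G H assume *: "G \<subseteq> H" "H \<subseteq> K n" "G \<in> up_closure n F"
    then obtain G' where "G' \<in> F" "G' \<subseteq> H" by (auto simp: up_closure_def)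
    then show "H \<in> up_closure n F" using *(2) by (auto simp: up_closure_def)
  qed
  show "odd_cycle_intersecting n (up_closure n F)"
    unfolding odd_cycle_intersecting_def
  proof (intro conjI ballI)
    show "up_closure n F \<subseteq> Pow (K n)" by (auto simp: up_closure_def)
    fix G H assume "G \<in> up_closure n F" "H \<in> up_closure n F"
    then obtain G' H' where "G' \<in> F" "G' \<subseteq> G" "H' \<in> F" "H' \<subseteq> H" by (auto simp: up_closure_def)
    moreover from this have "contains_odd_cycle (G' \<inter> H')" using assms by (simp add: odd_cycle_intersecting_def)
    ultimately show "contains_odd_cycle (G \<inter> H)" by (meson Int_mono contains_odd_cycle_mono)
  qed
qed

lemma increasing_intersecting_powr_le:
  assumes F: "odd_cycle_intersecting n F" "increasing_on (K n) (\<lambda>G. G \<in> F)"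
    and p: "0 < p" "p \<le> 1/2" and \<alpha>: "0 < \<alpha>" "\<alpha> \<le> 1" "p powr \<alpha> = 1/2"
  shows "mu n p F powr \<alpha> \<le> density (K n) (\<lambda>G. G \<in> F)"
proof -
  have "F \<subseteq> Pow (K n)" using F(1) by (simp add: odd_cycle_intersecting_def)
  then show ?thesis
    using bias_powr_le[OF finite_K F(2) p(1) _ \<alpha>] p(2) by (simp add: mu_eq_bias bias_half)
qed

lemma cube_powr:
  fixes p :: real
  assumes "0 < p" "p powr \<alpha> = 1/2" shows "(p ^ 3) powr \<alpha> = 1/8"
proof -
  have "(p ^ 3) powr \<alpha> = (p powr \<alpha>) ^ 3"
    using assms(1) by (simp add: power3_eq_cube powr_mult)
  then show ?thesis unfolding assms(2) by (simp add: power3_eq_cube)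
qed

lemma mu_mono:
  assumes "0 \<le> p" "p \<le> 1" "F \<subseteq> F'" "F' \<subseteq> Pow (K n)"
  shows "mu n p F \<le> mu n p F'"
  using assms by (subst (1 2) mu_eq_bias) (auto intro!: bias_mono)

lemma intersecting_mu_le:
  assumes F: "odd_cycle_intersecting n F" and p: "0 < p" "p \<le> 1/2"
  shows "mu n p F \<le> p ^ 3"
proof -
  obtain \<alpha> where \<alpha>: "0 < \<alpha>" "\<alpha> \<le> 1" "p powr \<alpha> = 1/2" using ex_half_exponent[OF p] .
  let ?F = "up_closure n F"
  have "mu n p ?F powr \<alpha> \<le> density (K n) (\<lambda>G. G \<in> ?F)"
    by (rule increasing_intersecting_powr_le[OF up_closure(2,3)[OF F] p \<alpha>])
  also have "\<dots> \<le> 1/8" by (intro agreeing_density_le intersecting_imp_agreeing up_closure(2)[OF F])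
  also have "\<dots> = (p ^ 3) powr \<alpha>" using cube_powr p(1) \<alpha>(3) by simp
  finally have "\<not> p ^ 3 < mu n p ?F"
    using powr_less_mono2[of \<alpha> "p ^ 3" "mu n p ?F"] \<alpha>(1) p(1) by auto
  moreover have "mu n p F \<le> mu n p ?F"
    using p up_closure(1)[OF F] by (intro mu_mono) (auto simp: up_closure_def)
  ultimately show ?thesis by simp
qed

text \<open>The comparison sends p ^ 3 to 1/8 and the relative size t = 1 - \<epsilon> / p ^ 3 to t
  powr \<alpha> \<ge> t. This is the source of the factor 1 / p ^ 3 in the stability
  constant.\<close>

lemma up_closure_density_ge:
  assumes F: "odd_cycle_intersecting n F" and p: "0 < p" "p \<le> 1/2"
    and \<epsilon>: "0 \<le> \<epsilon>" "\<epsilon> < p ^ 3" and mu: "p ^ 3 - \<epsilon> \<le> mu n p F"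
  shows "1/8 - \<epsilon> / (8 * p ^ 3) \<le> density (K n) (\<lambda>G. G \<in> up_closure n F)"
proof -
  obtain \<alpha> where \<alpha>: "0 < \<alpha>" "\<alpha> \<le> 1" "p powr \<alpha> = 1/2" using ex_half_exponent[OF p] .
  let ?F = "up_closure n F" and ?t = "1 - \<epsilon> / p ^ 3"
  have p3: "0 < p ^ 3" using p by simp
  have t: "0 < ?t" "?t \<le> 1" using \<epsilon> p3 by simp_all
  have "?t = ?t powr 1" using t by simp
  also have "\<dots> \<le> ?t powr \<alpha>" using t \<alpha> by (intro powr_mono') auto
  finally have "1/8 * ?t \<le> 1/8 * ?t powr \<alpha>" by (rule mult_left_mono) simp
  also have "\<dots> = (p ^ 3 * ?t) powr \<alpha>"
    using cube_powr[OF p(1) \<alpha>(3)] t p3 by (simp only: powr_mult)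
  also have "p ^ 3 * ?t = p ^ 3 - \<epsilon>" using p3 by (simp add: field_simps)
  also have "(p ^ 3 - \<epsilon>) powr \<alpha> \<le> mu n p ?F powr \<alpha>"
  proof -
    have "mu n p F \<le> mu n p ?F"
      using p up_closure(1)[OF F] by (intro mu_mono) (auto simp: up_closure_def)
    then show ?thesis using mu \<alpha> \<epsilon> by (intro powr_mono2) auto
  qed
  also have "\<dots> \<le> density (K n) (\<lambda>G. G \<in> ?F)"
    by (rule increasing_intersecting_powr_le[OF up_closure(2,3)[OF F] p \<alpha>])
  finally show ?thesis by (simp add: algebra_simps)
qed

lemma density_Ex_le:
  assumes "finite A"
  shows "density E (\<lambda>Z. \<exists>Y\<in>A. P Y Z) \<le> (\<Sum>Y\<in>A. density E (P Y))"
  using assms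
proof (induction A)
  case empty
  show ?case by (simp add: density_def)
next
  case (insert a A)
  have "density E (\<lambda>Z. \<exists>Y\<in>insert a A. P Y Z) \<le> density E (P a) + density E (\<lambda>Z. \<exists>Y\<in>A. P Y Z)"
    by (rule density_disj_le) auto
  then show ?case using insert by simp
qed

text \<open>Forgetting the edges in \<open>T\<close> turns the part of \<open>F\<close> outside the family of supersets of \<open>T\<close>
  into an increasing family, whose biased measure is at most the uniform one.\<close>

lemma bias_outside_le:
  assumes T: "triangle n T" and inc: "increasing_on (K n) (\<lambda>G. G \<in> F)" and p: "0 < p" "p \<le> 1/2"
  shows "bias (K n) p (\<lambda>G. G \<in> F \<and> \<not> T \<subseteq> G) \<le> 8 * density (K n) (\<lambda>G. G \<in> F \<and> \<not> T \<subseteq> G)"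
proof -
  have TE: "T \<subseteq> K n" by (rule triangle_subset_K[OF T])
  have finT: "finite T" using TE finite_K finite_subset by blast
  note slices = density_slices[OF finite_K TE, unfolded power3_triangle[OF T]]
  let ?A = "\<lambda>G. \<exists>Y\<in>Pow T - {T}. Y \<union> (G - T) \<in> F"
  have "bias (K n) p (\<lambda>G. G \<in> F \<and> \<not> T \<subseteq> G) \<le> bias (K n) p ?A"
  proof (rule bias_mono)
    fix G assume G: "G \<in> F \<and> \<not> T \<subseteq> G"
    have "G \<inter> T \<union> (G - T) = G" by blast
    then show "?A G" using G by (intro bexI[of _ "G \<inter> T"]) auto
  qed (use p in auto)
  \<comment> \<open>\<open>?A\<close> ignores the edges of \<open>T\<close>, so it is increasing
    although the family that it replaces need not be.\<close>
  also have "\<dots> \<le> bias (K n) (1/2) ?A"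
  proof (rule bias_le_half[OF finite_K _ p])
    show "increasing_on (K n) ?A"
      unfolding increasing_on_def
    proof (intro allI impI, elim conjE bexE)
      fix G H Y assume *: "G \<subseteq> H" "H \<subseteq> K n" "Y \<in> Pow T - {T}" "Y \<union> (G - T) \<in> F"
      then have "Y \<union> (G - T) \<subseteq> Y \<union> (H - T)" "Y \<union> (H - T) \<subseteq> K n" using TE by auto
      then have "Y \<union> (H - T) \<in> F" using inc *(4) unfolding increasing_on_def by blast
      then show "\<exists>Y\<in>Pow T - {T}. Y \<union> (H - T) \<in> F" using *(3) by blast
    qed
  qed
  also have "\<dots> = density (K n) ?A" by (simp add: bias_half)
  also have "\<dots> = (\<Sum>X\<in>Pow T. density (K n - T) (\<lambda>Z. \<exists>Y\<in>Pow T - {T}. Y \<union> Z \<in> F)) / 8"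
  proof (subst slices, intro arg_cong[where f = "\<lambda>x. x / 8"] sum.cong refl)
    fix X assume "X \<in> Pow T"
    then have "X \<union> Z - T = Z" if "Z \<in> Pow (K n - T)" for Z using that by blast
    then show "density (K n - T) (\<lambda>Z. \<exists>Y\<in>Pow T - {T}. Y \<union> (X \<union> Z - T) \<in> F)
      = density (K n - T) (\<lambda>Z. \<exists>Y\<in>Pow T - {T}. Y \<union> Z \<in> F)"
      unfolding density_def by (intro arg_cong[where f = "\<lambda>x. x / _"] sum.cong) auto
  qed
  also have "\<dots> = density (K n - T) (\<lambda>Z. \<exists>Y\<in>Pow T - {T}. Y \<union> Z \<in> F)"
    using power3_triangle[OF T] finT by (simp add: card_Pow)
  also have "\<dots> \<le> (\<Sum>Y\<in>Pow T - {T}. density (K n - T) (\<lambda>Z. Y \<union> Z \<in> F))"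
    using finT by (intro density_Ex_le) simp
  also have "\<dots> = (\<Sum>Y\<in>Pow T - {T}. density (K n - T) (\<lambda>Z. Y \<union> Z \<in> F \<and> \<not> T \<subseteq> Y \<union> Z))"
  proof (intro sum.cong refl)
    fix Y assume "Y \<in> Pow T - {T}"
    then have "\<not> T \<subseteq> Y \<union> Z" if "Z \<in> Pow (K n - T)" for Z using that by blast
    then show "density (K n - T) (\<lambda>Z. Y \<union> Z \<in> F) = density (K n - T) (\<lambda>Z. Y \<union> Z \<in> F \<and> \<not> T \<subseteq> Y \<union> Z)"
      unfolding density_def by (intro arg_cong[where f = "\<lambda>x. x / _"] sum.cong) auto
  qed
  also have "\<dots> \<le> (\<Sum>Y\<in>Pow T. density (K n - T) (\<lambda>Z. Y \<union> Z \<in> F \<and> \<not> T \<subseteq> Y \<union> Z))"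
    using finT by (intro sum_mono2) (auto simp: density_nonneg)
  also have "\<dots> = 8 * density (K n) (\<lambda>G. G \<in> F \<and> \<not> T \<subseteq> G)"
    by (subst slices) simp
  finally show ?thesis .
qed

text \<open>Otherwise the slice at \<open>X\<close> is more than half full and, by monotonicity, so
  is the slice at \<open>T\<close>; together they exceed what density 1/8 allows.\<close>

lemma increasing_near_junta_is_superset:
  assumes T: "triangle n T" and X: "X \<subseteq> T" and inc: "increasing_on (K n) (\<lambda>G. G \<in> F)"
    and le: "density (K n) (\<lambda>G. G \<in> F) \<le> 1/8"
    and near: "density (K n) (\<lambda>G. G \<in> sym_diff (junta n T X) F) < 1/16"
  shows "X = T"
proof (rule ccontr)
  assume ne: "X \<noteq> T"
  have TE: "T \<subseteq> K n" by (rule triangle_subset_K[OF T])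
  have finT: "finite T" using TE finite_K finite_subset by blast
  note slices = density_slices[OF finite_K TE, unfolded power3_triangle[OF T]]
  let ?m = "\<lambda>X. density (K n - T) (\<lambda>Z. X \<union> Z \<in> F)"
  have "1 - ?m X = density (K n - T) (\<lambda>Z. X \<union> Z \<notin> F)" by (simp add: density_not)
  also have "\<dots> \<le> density (K n - T) (\<lambda>Z. X \<union> Z \<in> sym_diff (junta n T X) F)"
    using X TE by (intro density_mono) (auto simp: junta_def)
  also have "\<dots> \<le> (\<Sum>Y\<in>Pow T. density (K n - T) (\<lambda>Z. Y \<union> Z \<in> sym_diff (junta n T X) F))"
    using X finT by (intro member_le_sum[of X "Pow T" "\<lambda>Y. density (K n - T) (\<lambda>Z. Y \<union> Z \<in> sym_diff (junta n T X) F)"])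
      (auto simp: density_nonneg)
  also have "\<dots> = 8 * density (K n) (\<lambda>G. G \<in> sym_diff (junta n T X) F)"
    by (subst slices) simp
  finally have "1/2 < ?m X" using near by simp
  moreover have "?m X \<le> ?m T"
  proof (rule density_mono)
    fix Z assume Z: "Z \<subseteq> K n - T" "X \<union> Z \<in> F"
    then have "X \<union> Z \<subseteq> T \<union> Z" "T \<union> Z \<subseteq> K n" using X TE by auto
    then show "T \<union> Z \<in> F" using inc Z(2) unfolding increasing_on_def by blast
  qed
  moreover have "?m X + ?m T = (\<Sum>Y\<in>{X, T}. ?m Y)" using ne by simp
  moreover have "(\<Sum>Y\<in>{X, T}. ?m Y) \<le> (\<Sum>Y\<in>Pow T. ?m Y)"
    using X finT by (intro sum_mono2) (auto simp: density_nonneg)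
  moreover have "(\<Sum>Y\<in>Pow T. ?m Y) = 8 * density (K n) (\<lambda>G. G \<in> F)"
    by (subst slices) simp
  ultimately show False using le by linarith
qed

lemma mu_superset: "T \<subseteq> K n \<Longrightarrow> mu n p (junta n T T) = p ^ card T"
proof -
  assume T: "T \<subseteq> K n"
  have "mu n p (junta n T T) = bias (K n) p (\<lambda>G. T \<subseteq> G)"
    by (subst mu_eq_bias) (auto simp: junta_def intro!: bias_cong)
  then show ?thesis using bias_superset[OF finite_K T] by simp
qed

lemma mu_le_1: "F \<subseteq> Pow (K n) \<Longrightarrow> 0 \<le> p \<Longrightarrow> p \<le> 1 \<Longrightarrow> mu n p F \<le> 1"
  by (simp add: mu_eq_bias bias_le_1)

text \<open>Only the part of \<open>F\<close> outside the \<triangle>umvirate has to be bounded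
  through the up-closure. Since the \<triangle>umvirate has measure p ^ 3, what \<open>F\<close>
  lacks inside it exceeds that part by at most \<epsilon>.\<close>

lemma intersecting_stability:
  assumes n: "3 \<le> n" and F: "odd_cycle_intersecting n F" and p: "0 < p" "p \<le> 1/2"
    and \<epsilon>: "0 \<le> \<epsilon>" and mu: "p ^ 3 - \<epsilon> \<le> mu n p F"
  shows "\<exists>T. triangle n T \<and> mu n p (sym_diff (junta n T T) F) \<le> 10 ^ 9 / p ^ 3 * \<epsilon>"
proof -
  have p3: "0 < p ^ 3" "p ^ 3 \<le> 1" using p by (simp_all add: power_le_one)
  have FK: "F \<subseteq> Pow (K n)" using F by (simp add: odd_cycle_intersecting_def)
  have sub: "sym_diff (junta n T T) F \<subseteq> Pow (K n)" for T using FK by (auto simp: junta_def)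
  show ?thesis
  proof (cases "p ^ 3 \<le> 10 ^ 9 * \<epsilon>")
    case True
    obtain T where "triangle n T" using ex_triangle[OF n] by blast
    moreover have "mu n p (sym_diff (junta n T T) F) \<le> 1" using p by (intro mu_le_1 sub) auto
    moreover have "1 \<le> 10 ^ 9 / p ^ 3 * \<epsilon>" using True p3 by (simp add: field_simps)
    ultimately show ?thesis by (intro exI[of _ T]) simp
  next
    case False
    define \<delta> where "\<delta> = 10 ^ 8 * (\<epsilon> / (8 * p ^ 3))"
    have \<delta>: "0 \<le> \<delta>" "\<delta> < 1/16" using False \<epsilon> p3 by (simp_all add: \<delta>_def field_simps)
    let ?F = "up_closure n F"
    have agr: "odd_cycle_agreeing n ?F" by (intro intersecting_imp_agreeing up_closure(2)[OF F])
    have "1/8 - \<epsilon> / (8 * p ^ 3) \<le> density (K n) (\<lambda>G. G \<in> ?F)"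
      by (rule up_closure_density_ge[OF F p \<epsilon> _ mu]) (use False \<epsilon> in simp)
    then obtain T X where T: "triangle n T" and X: "X \<subseteq> T"
      and near: "density (K n) (\<lambda>G. G \<in> sym_diff (junta n T X) ?F) \<le> \<delta>"
      using agreeing_stability[OF n agr] unfolding \<delta>_def by blast
    have "X = T"
      by (rule increasing_near_junta_is_superset[OF T X up_closure(3)[OF F] agreeing_density_le[OF agr]])
        (use near \<delta> in linarith)
    let ?T = "junta n T T"
    have TK: "?T \<subseteq> Pow (K n)" by (auto simp: junta_def)
    have "mu n p (F - ?T) = bias (K n) p (\<lambda>G. G \<in> F - ?T)" using FK by (intro mu_eq_bias) auto
    also have "\<dots> \<le> bias (K n) p (\<lambda>G. G \<in> ?F \<and> \<not> T \<subseteq> G)"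
      using p up_closure(1)[OF F] by (intro bias_mono) (auto simp: junta_def)
    also have "\<dots> \<le> 8 * density (K n) (\<lambda>G. G \<in> ?F \<and> \<not> T \<subseteq> G)"
      by (rule bias_outside_le[OF T up_closure(3)[OF F] p])
    also have "density (K n) (\<lambda>G. G \<in> ?F \<and> \<not> T \<subseteq> G) \<le> density (K n) (\<lambda>G. G \<in> sym_diff (junta n T X) ?F)"
      unfolding \<open>X = T\<close> by (intro density_mono) (auto simp: junta_def)
    finally have out: "mu n p (F - ?T) \<le> 8 * \<delta>" using near by linarith
    have fin: "finite F" "finite ?T" using FK TK finite_subset[of _ "Pow (K n)"] by auto
    have "mu n p F = mu n p (F - ?T) + mu n p (F \<inter> ?T)"
      unfolding mu_def using fin by (subst sum.Int_Diff[of F _ ?T]) auto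
    moreover have "mu n p ?T = mu n p (?T - F) + mu n p (F \<inter> ?T)"
      unfolding mu_def using fin by (subst sum.Int_Diff[of ?T _ F]) (auto simp: Int_commute)
    moreover have "mu n p ?T = p ^ 3"
      using mu_superset[OF triangle_subset_K[OF T]] card_triangle[OF T] by simp
    moreover have "mu n p (sym_diff ?T F) = mu n p (?T - F) + mu n p (F - ?T)"
      unfolding mu_def using fin by (intro sum.union_disjoint) auto
    ultimately have "mu n p (sym_diff ?T F) \<le> \<epsilon> + 16 * \<delta>" using out mu by linarith
    also have "\<dots> \<le> 10 ^ 9 / p ^ 3 * \<epsilon>"
    proof -
      have "\<epsilon> \<le> \<epsilon> / p ^ 3" using \<epsilon> p3 by (simp add: field_simps mult_left_le)
      moreover have "\<delta> = 12500000 * (\<epsilon> / p ^ 3)" "10 ^ 9 / p ^ 3 * \<epsilon> = 1000000000 * (\<epsilon> / p ^ 3)"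
        by (simp_all add: \<delta>_def)
      moreover have "0 \<le> \<epsilon> / p ^ 3" using \<epsilon> p3 by simp
      ultimately show ?thesis by linarith
    qed
    finally show ?thesis using T by blast
  qed
qed

section \<open>Equality cases and conclusion\<close>

lemma junta_density:
  assumes T: "triangle n T" and X: "X \<subseteq> T"
  shows "density (K n) (\<lambda>G. G \<in> junta n T X) = 1/8"
proof -
  have TE: "T \<subseteq> K n" by (rule triangle_subset_K[OF T])
  have finT: "finite T" using TE finite_K finite_subset by blast
  have "density (K n) (\<lambda>G. G \<in> junta n T X)
      = (\<Sum>Y\<in>Pow T. density (K n - T) (\<lambda>Z. Y \<union> Z \<in> junta n T X)) / 8"
    by (rule density_slices[OF finite_K TE, unfolded power3_triangle[OF T]])
  also have "(\<Sum>Y\<in>Pow T. density (K n - T) (\<lambda>Z. Y \<union> Z \<in> junta n T X)) = (\<Sum>Y\<in>Pow T. if Y = X then 1 else 0)"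
  proof (intro sum.cong refl)
    fix Y assume Y: "Y \<in> Pow T"
    have "Y \<union> Z \<in> junta n T X \<longleftrightarrow> Y = X" if "Z \<in> Pow (K n - T)" for Z
    proof -
      have "(Y \<union> Z) \<inter> T = Y" "Y \<union> Z \<subseteq> K n" using that Y TE by auto
      then show ?thesis by (simp add: junta_def)
    qed
    then have "density (K n - T) (\<lambda>Z. Y \<union> Z \<in> junta n T X) = density (K n - T) (\<lambda>Z. Y = X)"
      unfolding density_def by (intro arg_cong[where f = "\<lambda>x. x / _"] sum.cong) auto
    then show "density (K n - T) (\<lambda>Z. Y \<union> Z \<in> junta n T X) = (if Y = X then 1 else 0)"
      by (simp add: density_def card_Pow)
  qed
  also have "\<dots> = 1" using X finT by (simp add: sum.delta')
  finally show ?thesis by simp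
qed

lemma mu_eq_0_iff:
  assumes "F \<subseteq> Pow (K n)" "0 < p" "p < 1"
  shows "mu n p F = 0 \<longleftrightarrow> F = {}"
proof -
  have "finite F" using assms(1) finite_subset by fastforce
  moreover have "0 < mu_graph n p G" for G using assms by (simp add: mu_graph_def)
  ultimately show ?thesis unfolding mu_def by (subst sum_nonneg_eq_0_iff) (auto simp: less_imp_le less_imp_neq[symmetric])
qed

lemma triangle_umvirate_iff: "triangle_umvirate n F \<longleftrightarrow> (\<exists>T. triangle n T \<and> F = junta n T T)"
proof -
  have "{G. G \<subseteq> K n \<and> T \<subseteq> G} = junta n T T" for T by (auto simp: junta_def)
  then show ?thesis by (simp add: triangle_umvirate_def)
qed

lemma triangle_junta_iff: "triangle_junta n F \<longleftrightarrow> (\<exists>T X. triangle n T \<and> X \<subseteq> T \<and> F = junta n T X)"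
  by (simp add: triangle_junta_def junta_def)

lemma mu_sym_diff_le_0:
  assumes "F \<subseteq> Pow (K n)" "F' \<subseteq> Pow (K n)" "0 < p" "p < 1" "mu n p (sym_diff F' F) \<le> 0"
  shows "F = F'"
proof -
  have sub: "sym_diff F' F \<subseteq> Pow (K n)" using assms(1,2) by blast
  have "0 \<le> mu n p (sym_diff F' F)" using assms(3,4) by (simp add: mu_eq_bias[OF sub] bias_nonneg)
  then have "sym_diff F' F = {}" using assms(3-5) mu_eq_0_iff[OF sub] by auto
  then show ?thesis by blast
qed

text \<open>Stability with \<epsilon> = 0 leaves a symmetric difference of measure 0, which is empty
  because every graph has positive measure.\<close>

lemma intersecting_eq_iff:
  assumes n: "3 \<le> n" and F: "odd_cycle_intersecting n F" and p: "0 < p" "p \<le> 1/2"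
  shows "mu n p F = p ^ 3 \<longleftrightarrow> triangle_umvirate n F"
proof
  assume "mu n p F = p ^ 3"
  then obtain T where T: "triangle n T" "mu n p (sym_diff (junta n T T) F) \<le> 0"
    using intersecting_stability[OF n F p, of 0] by auto
  have "F = junta n T T"
    by (rule mu_sym_diff_le_0[OF _ _ _ _ T(2)]) (use F p in \<open>auto simp: odd_cycle_intersecting_def junta_def\<close>)
  then show "triangle_umvirate n F" using T(1) by (auto simp: triangle_umvirate_iff)
next
  assume "triangle_umvirate n F"
  then show "mu n p F = p ^ 3"
    using mu_superset triangle_subset_K card_triangle by (auto simp: triangle_umvirate_iff)
qed

lemma agreeing_stability_mu:
  assumes n: "3 \<le> n" and F: "odd_cycle_agreeing n F" and mu: "1/8 - \<epsilon> \<le> mu n (1/2) F"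
  shows "\<exists>T X. triangle n T \<and> X \<subseteq> T \<and> mu n (1/2) (sym_diff (junta n T X) F) \<le> 10 ^ 8 * \<epsilon>"
proof -
  have FK: "F \<subseteq> Pow (K n)" using F by (simp add: odd_cycle_agreeing_def)
  have "sym_diff (junta n T X) F \<subseteq> Pow (K n)" for T X using FK by (auto simp: junta_def)
  then have eq: "mu n (1/2) (sym_diff (junta n T X) F) = density (K n) (\<lambda>G. G \<in> sym_diff (junta n T X) F)" for T X
    by (rule mu_half)
  show ?thesis unfolding eq
    by (rule agreeing_stability[OF n F]) (use mu mu_half[OF FK] in simp)
qed

lemma agreeing_eq_iff:
  assumes n: "3 \<le> n" and F: "odd_cycle_agreeing n F"
  shows "mu n (1/2) F = 1/8 \<longleftrightarrow> triangle_junta n F"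
proof
  assume "mu n (1/2) F = 1/8"
  then obtain T X where T: "triangle n T" "X \<subseteq> T" "mu n (1/2) (sym_diff (junta n T X) F) \<le> 0"
    using agreeing_stability_mu[OF n F, of 0] by auto
  have "F = junta n T X"
    by (rule mu_sym_diff_le_0[OF _ _ _ _ T(3)]) (use F in \<open>auto simp: odd_cycle_agreeing_def junta_def\<close>)
  then show "triangle_junta n F" using T(1,2) by (auto simp: triangle_junta_iff)
next
  assume "triangle_junta n F"
  then obtain T X where T: "triangle n T" "X \<subseteq> T" "F = junta n T X" by (auto simp: triangle_junta_iff)
  then show "mu n (1/2) F = 1/8"
    using junta_density[OF T(1,2)] by (subst mu_half) (auto simp: junta_def)
qed

theorem theorem1p2:
  shows "(\<forall>n::nat. n \<ge> 3 \<longrightarrow>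
            (\<forall>p::real. 0 < p \<and> p \<le> 1/2 \<longrightarrow>
               (\<forall>F. odd_cycle_intersecting n F \<longrightarrow>
                  mu n p F \<le> p ^ 3 \<and> (mu n p F = p ^ 3 \<longleftrightarrow> triangle_umvirate n F))) \<and>
            (\<forall>F. odd_cycle_agreeing n F \<longrightarrow>
               mu n (1/2) F \<le> 1/8 \<and> (mu n (1/2) F = 1/8 \<longleftrightarrow> triangle_junta n F)))
       \<and> (\<exists>c :: real \<Rightarrow> real.
            (\<forall>\<delta>>0. bdd_above (c ` {\<delta>..1/2})) \<and>
            (\<forall>n::nat. n \<ge> 3 \<longrightarrow>
               (\<forall>p::real. 0 < p \<and> p \<le> 1/2 \<longrightarrow>
                  (\<forall>\<epsilon>\<ge>0. \<forall>F. odd_cycle_intersecting n F \<and> mu n p F \<ge> p ^ 3 - \<epsilon> \<longrightarrow>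
                     (\<exists>\<T>. triangle_umvirate n \<T> \<and> mu n p (sym_diff \<T> F) \<le> c p * \<epsilon>))) \<and>
               (\<forall>\<epsilon>\<ge>0. \<forall>F. odd_cycle_agreeing n F \<and> mu n (1/2) F \<ge> 1/8 - \<epsilon> \<longrightarrow>
                  (\<exists>\<T>. triangle_junta n \<T> \<and> mu n (1/2) (sym_diff \<T> F) \<le> c (1/2) * \<epsilon>))))"
proof (intro conjI allI impI; (elim conjE)?)
  fix n :: nat and p :: real and F
  assume *: "3 \<le> n" "0 < p" "p \<le> 1/2" "odd_cycle_intersecting n F"
  show "mu n p F \<le> p ^ 3" by (rule intersecting_mu_le[OF *(4,2,3)])
  show "mu n p F = p ^ 3 \<longleftrightarrow> triangle_umvirate n F" by (rule intersecting_eq_iff[OF *(1,4,2,3)])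
next
  fix n F assume *: "3 \<le> n" "odd_cycle_agreeing n F"
  then have "F \<subseteq> Pow (K n)" by (simp add: odd_cycle_agreeing_def)
  then show "mu n (1/2) F \<le> 1/8" using agreeing_density_le[OF *(2)] by (simp add: mu_half)
  show "mu n (1/2) F = 1/8 \<longleftrightarrow> triangle_junta n F" by (rule agreeing_eq_iff[OF *])
next
  define c where "c p = 10 ^ 9 / p ^ 3" for p :: real
  show "\<exists>c :: real \<Rightarrow> real.
            (\<forall>\<delta>>0. bdd_above (c ` {\<delta>..1/2})) \<and>
            (\<forall>n::nat. n \<ge> 3 \<longrightarrow>
               (\<forall>p::real. 0 < p \<and> p \<le> 1/2 \<longrightarrow>
                  (\<forall>\<epsilon>\<ge>0. \<forall>F. odd_cycle_intersecting n F \<and> mu n p F \<ge> p ^ 3 - \<epsilon> \<longrightarrow>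
                     (\<exists>\<T>. triangle_umvirate n \<T> \<and> mu n p (sym_diff \<T> F) \<le> c p * \<epsilon>))) \<and>
               (\<forall>\<epsilon>\<ge>0. \<forall>F. odd_cycle_agreeing n F \<and> mu n (1/2) F \<ge> 1/8 - \<epsilon> \<longrightarrow>
                  (\<exists>\<T>. triangle_junta n \<T> \<and> mu n (1/2) (sym_diff \<T> F) \<le> c (1/2) * \<epsilon>)))"
  proof (intro exI[of _ c] conjI allI impI; (elim conjE)?)
    fix \<delta> :: real assume \<delta>: "0 < \<delta>"
    have "c p \<le> 10 ^ 9 / \<delta> ^ 3" if "p \<in> {\<delta>..1/2}" for p
      unfolding c_def using that \<delta> by (intro divide_left_mono power_mono) auto
    then show "bdd_above (c ` {\<delta>..1/2})" by (rule bdd_aboveI2)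
  next
    fix n :: nat and p \<epsilon> :: real and F
    assume *: "3 \<le> n" "0 < p" "p \<le> 1/2" "0 \<le> \<epsilon>" "odd_cycle_intersecting n F" "p ^ 3 - \<epsilon> \<le> mu n p F"
    obtain T where "triangle n T" "mu n p (sym_diff (junta n T T) F) \<le> c p * \<epsilon>"
      using intersecting_stability[OF *(1,5,2,3,4,6)] unfolding c_def by blast
    then show "\<exists>\<T>. triangle_umvirate n \<T> \<and> mu n p (sym_diff \<T> F) \<le> c p * \<epsilon>"
      by (intro exI[of _ "junta n T T"]) (auto simp: triangle_umvirate_iff)
  next
    fix n :: nat and \<epsilon> :: real and F
    assume *: "3 \<le> n" "0 \<le> \<epsilon>" "odd_cycle_agreeing n F" "1/8 - \<epsilon> \<le> mu n (1/2) F"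
    obtain T X where T: "triangle n T" "X \<subseteq> T" "mu n (1/2) (sym_diff (junta n T X) F) \<le> 10 ^ 8 * \<epsilon>"
      using agreeing_stability_mu[OF *(1,3,4)] by blast
    moreover have "10 ^ 8 * \<epsilon> \<le> c (1/2) * \<epsilon>"
      using *(2) by (intro mult_right_mono) (simp_all add: c_def power3_eq_cube)
    ultimately have "mu n (1/2) (sym_diff (junta n T X) F) \<le> c (1/2) * \<epsilon>" by linarith
    then show "\<exists>\<T>. triangle_junta n \<T> \<and> mu n (1/2) (sym_diff \<T> F) \<le> c (1/2) * \<epsilon>"
      using T(1,2) by (intro exI[of _ "junta n T X"]) (auto simp: triangle_junta_iff)
  qed
qed

end
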